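(* Let $M=(M_1\times_f M_2)\times_h M_3$ be a sequential warped product equipped with the metric $g=(g_1\oplus f^2g_2)\oplus h^2g_3$. If $(M,g,X,\lambda,\rho)$ is a Ricci-Bourguignon soliton and $X$ is a Killing vector field on $(M,g)$, then: (i) $(M_1,g_1)$ is an Einstein manifold when $\mathrm{Hess} f=\sigma g$ and $\overline{\mathrm{Hess}}\,h=\psi g$ for smooth functions $\sigma,\psi$. (ii) $(M_2,g_2)$ is an Einstein manifold when $\overline{\mathrm{Hess}}\,h=\psi g$ for a smooth function $\psi$. (iii) $(M_3,g_3)$ is an Einstein manifold.
   Context: Let $(M_i,g_i)$, $1\le i\le 3$, be semi-Riemannian manifolds of dimension $n_i$, and let $f:M_1\to\mathbb{R}^+$, $h:M_1\times M_2\to\mathbb{R}^+$ be smooth functions (the warping functions). The sequential warped product $M=(M_1\times_f M_2)\times_h M_3$ is the manifold $M_1\times M_2\times M_3$ with metric $g=(g_1\oplus f^2g_2)\oplus h^2g_3$. Functions and vector fields on the factors are identified with their lifts to $M$. Put $\overline M=M_1\times M_2$ with the metric $g_1\oplus f^2g_2$. $\mathrm{Hess}$ is the Hessian on $(M,g)$ and $\overline{\mathrm{Hess}}$ is the Hessian on $\overline M$. $\mathrm{Hess} f=\sigma g$ is an equality of bilinear forms on $M$; $\overline{\mathrm{Hess}}\,h=\psi g$ is an equality of bilinear forms on vectors tangent to $\overline M$ (where $g$ restricts to $g_1\oplus f^2g_2$). A Ricci-Bourguignon soliton $(M,g,X,\lambda,\rho)$ is a semi-Riemannian manifold $(M,g)$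 with a vector field $X$ and real constants $\lambda,\rho$ such that $\mathrm{Ric}+\frac12\mathcal{L}_Xg=\lambda g+\rho Rg$, where $R$ is the scalar curvature of $g$. A vector field $V$ on $(N,g_N)$ is Killing if $\mathcal{L}_Vg_N=0$. $(N,g_N)$ is called Einstein if its Ricci tensor is $\mu g_N$ for some smooth function $\mu$ on $N$ (the factor). *)

theory Defs
  imports "HOL-Analysis.Analysis"
begin

text \<open>Only meaningful for open \<open>S\<close>; derivatives are not taken relative to \<open>S\<close>.\<close>

primrec Ck_on :: "nat \<Rightarrow> 'e::euclidean_space set \<Rightarrow> ('e \<Rightarrow> 'v::real_normed_vector) \<Rightarrow> bool" where
  "Ck_on 0 S F \<longleftrightarrow> continuous_on S F"
| "Ck_on (Suc k) S F \<longleftrightarrow>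
     (\<forall>x\<in>S. F differentiable (at x)) \<and>
     (\<forall>v. Ck_on k S (\<lambda>x. frechet_derivative F (at x) v))"

definition smooth_on :: "'e::euclidean_space set \<Rightarrow> ('e \<Rightarrow> 'v::real_normed_vector) \<Rightarrow> bool" where
  "smooth_on S F \<longleftrightarrow> (\<forall>k. Ck_on k S F)"

abbreviation pd :: "'e::euclidean_space \<Rightarrow> ('e \<Rightarrow> 'v::real_normed_vector) \<Rightarrow> 'e \<Rightarrow> 'v" where
  "pd a F x \<equiv> frechet_derivative F (at x) a"

text \<open>
  The underlying space of a manifold is a whole type \<open>'a\<close>; being Hausdorff and second countable
  is expressed by type classes. The model space is a Euclidean space \<open>'e\<close>, so the dimension
  is \<open>DIM('e)\<close>. The smooth structure is given by an atlas that need not be maximal: a maximal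
  atlas is also admissible, and two compatible atlases give the same tensor fields.
\<close>

type_synonym ('a, 'e) chart = "'a set \<times> ('a \<Rightarrow> 'e)"

abbreviation chart_dom :: "('a, 'e) chart \<Rightarrow> 'a set" where "chart_dom c \<equiv> fst c"
abbreviation chart_map :: "('a, 'e) chart \<Rightarrow> 'a \<Rightarrow> 'e" where "chart_map c \<equiv> snd c"

abbreviation chart_image :: "('a, 'e) chart \<Rightarrow> 'e set" where
  "chart_image c \<equiv> chart_map c ` chart_dom c"

abbreviation chart_inv :: "('a, 'e) chart \<Rightarrow> 'e \<Rightarrow> 'a" where
  "chart_inv c \<equiv> inv_into (chart_dom c) (chart_map c)"

definition is_chart :: "('a::topological_space, 'e::euclidean_space) chart \<Rightarrow> bool" where
  "is_chart c \<longleftrightarrow> open (chart_dom c) \<and> open (chart_image c) \<and>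
     homeomorphism (chart_dom c) (chart_image c) (chart_map c) (chart_inv c)"

definition smooth_atlas :: "('a::topological_space, 'e::euclidean_space) chart set \<Rightarrow> bool" where
  "smooth_atlas A \<longleftrightarrow>
     (\<forall>c\<in>A. is_chart c) \<and>
     (\<Union>c\<in>A. chart_dom c) = UNIV \<and>
     (\<forall>c\<in>A. \<forall>d\<in>A. smooth_on (chart_map c ` (chart_dom c \<inter> chart_dom d)) (chart_map d \<circ> chart_inv c))"

definition smooth_fun :: "('a::topological_space, 'e::euclidean_space) chart set \<Rightarrow> ('a \<Rightarrow> real) \<Rightarrow> bool" where
  "smooth_fun A f \<longleftrightarrow> (\<forall>c\<in>A. smooth_on (chart_image c) (f \<circ> chart_inv c))"

definition product_chart :: "('a, 'd) chart \<Rightarrow> ('b, 'e) chart \<Rightarrow> ('a \<times> 'b, 'd \<times> 'e) chart" where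
  "product_chart c d = (chart_dom c \<times> chart_dom d, map_prod (chart_map c) (chart_map d))"

definition product_atlas ::
  "('a, 'd) chart set \<Rightarrow> ('b, 'e) chart set \<Rightarrow> ('a \<times> 'b, 'd \<times> 'e) chart set" where
  "product_atlas A B = {product_chart c d | c d. c \<in> A \<and> d \<in> B}"

text \<open>
  A tangent vector at \<open>p\<close> is a directional derivative, that is, an operator acting on the functions
  that are differentiable at \<open>p\<close> (a property that does not depend on the chart), and set to 0 on
  all other functions to make it a unique object. \<open>tangent c p w\<close> is the vector
  \<open>\<Sum>i. w\<^sup>i \<partial>\<^sub>i\<close> at \<open>p\<close> of the chart \<open>c\<close>.
\<close>

type_synonym 'a tangent = "('a \<Rightarrow> real) \<Rightarrow> real"

definition tangent :: "('a, 'e::euclidean_space) chart \<Rightarrow> 'a \<Rightarrow> 'e \<Rightarrow> 'a tangent" where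
  "tangent c p w = (\<lambda>f. if (f \<circ> chart_inv c) differentiable (at (chart_map c p))
                        then frechet_derivative (f \<circ> chart_inv c) (at (chart_map c p)) w else 0)"

definition tangent_space :: "('a, 'e::euclidean_space) chart set \<Rightarrow> 'a \<Rightarrow> 'a tangent set" where
  "tangent_space A p = {tangent c p w | c w. c \<in> A \<and> p \<in> chart_dom c}"

definition pushforward :: "('a \<Rightarrow> 'b) \<Rightarrow> 'a tangent \<Rightarrow> 'b tangent" where
  "pushforward \<pi> v = (\<lambda>f. v (f \<circ> \<pi>))"

type_synonym 'a vfield = "'a \<Rightarrow> 'a tangent"

text \<open>The coordinate expression \<open>x \<mapsto> \<Sum>i. X(c\<^sup>i) e\<^sub>i\<close> of a vector field in a chart.\<close>

definition vfield_coord :: "('a, 'e::euclidean_space) chart \<Rightarrow> 'a vfield \<Rightarrow> 'e \<Rightarrow> 'e" where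
  "vfield_coord c X x = (\<Sum>i\<in>Basis. X (chart_inv c x) (\<lambda>q. chart_map c q \<bullet> i) *\<^sub>R i)"

definition smooth_vfield ::
  "('a::topological_space, 'e::euclidean_space) chart set \<Rightarrow> 'a vfield \<Rightarrow> bool" where
  "smooth_vfield A X \<longleftrightarrow> (\<forall>p. X p \<in> tangent_space A p) \<and>
     (\<forall>c\<in>A. smooth_on (chart_image c) (vfield_coord c X))"

type_synonym 'a metric_tensor = "'a \<Rightarrow> 'a tangent \<Rightarrow> 'a tangent \<Rightarrow> real"

text \<open>
  The coordinate expression of a (0,2)-tensor: a form on the model space for each point of the
  image of the chart, with components \<open>g\<^sub>i\<^sub>j(x) = metric_coord c g x e\<^sub>i e\<^sub>j\<close>.
\<close>

definition metric_coord ::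
  "('a, 'e::euclidean_space) chart \<Rightarrow> 'a metric_tensor \<Rightarrow> 'e \<Rightarrow> 'e \<Rightarrow> 'e \<Rightarrow> real" where
  "metric_coord c g x u w =
     g (chart_inv c x) (tangent c (chart_inv c x) u) (tangent c (chart_inv c x) w)"

definition form_index :: "('e::euclidean_space \<Rightarrow> 'e \<Rightarrow> real) \<Rightarrow> nat" where
  "form_index B = Max (dim ` {W. subspace W \<and> (\<forall>w\<in>W. w \<noteq> 0 \<longrightarrow> B w w < 0)})"

text \<open>Smooth, symmetric, nondegenerate, of constant index. Bilinearity and the other pointwise
  conditions are expressed through \<open>tangent c p\<close>, which is onto the tangent space at \<open>p\<close>.\<close>

definition semi_riemannian ::
  "('a::topological_space, 'e::euclidean_space) chart set \<Rightarrow> 'a metric_tensor \<Rightarrow> bool" where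
  "semi_riemannian A g \<longleftrightarrow> smooth_atlas A \<and>
     (\<forall>c\<in>A. \<forall>u w. smooth_on (chart_image c) (\<lambda>x. metric_coord c g x u w)) \<and>
     (\<forall>c\<in>A. \<forall>x\<in>chart_image c.
        bilinear (metric_coord c g x) \<and>
        (\<forall>u w. metric_coord c g x u w = metric_coord c g x w u) \<and>
        (\<forall>u. (\<forall>w. metric_coord c g x u w = 0) \<longrightarrow> u = 0)) \<and>
     (\<exists>\<nu>. \<forall>c\<in>A. \<forall>x\<in>chart_image c. form_index (metric_coord c g x) = \<nu>)"

definition warped_metric ::
  "'a metric_tensor \<Rightarrow> ('a \<Rightarrow> real) \<Rightarrow> 'b metric_tensor \<Rightarrow> ('a \<times> 'b) metric_tensor" where
  "warped_metric g f g' p u v =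
     g (fst p) (pushforward fst u) (pushforward fst v) +
     (f (fst p))\<^sup>2 * g' (snd p) (pushforward snd u) (pushforward snd v)"

text \<open>
  In the following, \<open>G\<close> is the coordinate expression of a metric. Elements \<open>a, b\<close> of the model space
  stand for the coordinate vector fields with constant components, which commute.
\<close>

text \<open>The vector metrically equivalent to the linear form \<open>l\<close>; \<open>sharp G x (\<lambda>w. w \<bullet> i) \<bullet> j\<close>
  is the entry \<open>g\<^sup>i\<^sup>j\<close> of the inverse of the metric.\<close>

definition sharp :: "('e \<Rightarrow> 'e \<Rightarrow> 'e \<Rightarrow> real) \<Rightarrow> 'e \<Rightarrow> ('e \<Rightarrow> real) \<Rightarrow> 'e" where
  "sharp G x l = (THE v. \<forall>w. G x v w = l w)"

text \<open>The Levi-Civita derivative \<open>\<nabla>\<^sub>a b\<close>, by the Koszul formula (all brackets vanish);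
  the \<open>k\<close>-th component of \<open>christoffel G x e\<^sub>i e\<^sub>j\<close> is \<open>\<Gamma>\<^sup>k\<^sub>i\<^sub>j\<close>.\<close>

definition christoffel ::
  "('e::euclidean_space \<Rightarrow> 'e \<Rightarrow> 'e \<Rightarrow> real) \<Rightarrow> 'e \<Rightarrow> 'e \<Rightarrow> 'e \<Rightarrow> 'e" where
  "christoffel G x a b = sharp G x (\<lambda>w.
     (pd a (\<lambda>y. G y b w) x + pd b (\<lambda>y. G y a w) x - pd w (\<lambda>y. G y a b) x) / 2)"

text \<open>\<open>R(a,b)z = \<nabla>\<^sub>a \<nabla>\<^sub>b z - \<nabla>\<^sub>b \<nabla>\<^sub>a z\<close>, and \<open>Ric(b,z)\<close> is the trace of \<open>a \<mapsto> R(a,b)z\<close>.\<close>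

definition riemann_local ::
  "('e::euclidean_space \<Rightarrow> 'e \<Rightarrow> 'e \<Rightarrow> real) \<Rightarrow> 'e \<Rightarrow> 'e \<Rightarrow> 'e \<Rightarrow> 'e \<Rightarrow> 'e" where
  "riemann_local G x a b z =
     (pd a (\<lambda>y. christoffel G y b z) x + christoffel G x a (christoffel G x b z)) -
     (pd b (\<lambda>y. christoffel G y a z) x + christoffel G x b (christoffel G x a z))"

definition ricci_local ::
  "('e::euclidean_space \<Rightarrow> 'e \<Rightarrow> 'e \<Rightarrow> real) \<Rightarrow> 'e \<Rightarrow> 'e \<Rightarrow> 'e \<Rightarrow> real" where
  "ricci_local G x b z = (\<Sum>i\<in>Basis. riemann_local G x i b z \<bullet> i)"

definition scalar_local :: "('e::euclidean_space \<Rightarrow> 'e \<Rightarrow> 'e \<Rightarrow> real) \<Rightarrow> 'e \<Rightarrow> real" where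
  "scalar_local G x = (\<Sum>i\<in>Basis. ricci_local G x i (sharp G x (\<lambda>w. w \<bullet> i)))"

text \<open>\<open>Hess F(a,b) = a(b(F)) - (\<nabla>\<^sub>a b)(F)\<close>.\<close>

definition hessian_local ::
  "('e::euclidean_space \<Rightarrow> 'e \<Rightarrow> 'e \<Rightarrow> real) \<Rightarrow> ('e \<Rightarrow> real) \<Rightarrow> 'e \<Rightarrow> 'e \<Rightarrow> 'e \<Rightarrow> real" where
  "hessian_local G F x a b = pd a (\<lambda>y. pd b F y) x - pd (christoffel G x a b) F x"

text \<open>\<open>(L\<^sub>X g)(a,b) = X(g(a,b)) - g([X,a],b) - g(a,[X,b])\<close> with \<open>[X,a] = -\<partial>\<^sub>a X\<close>.\<close>

definition lie_local ::
  "('e::euclidean_space \<Rightarrow> 'e) \<Rightarrow> ('e \<Rightarrow> 'e \<Rightarrow> 'e \<Rightarrow> real) \<Rightarrow> 'e \<Rightarrow> 'e \<Rightarrow> 'e \<Rightarrow> real" where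
  "lie_local X G x a b = pd (X x) (\<lambda>y. G y a b) x + G x (pd a X x) b + G x a (pd b X x)"

text \<open>The (0,2)-tensors below are given by their coordinate expressions, in every chart of the atlas,
  and an equation between tensors is the equation of the coordinate expressions in all charts.\<close>

abbreviation ricci :: "('a, 'e::euclidean_space) chart \<Rightarrow> 'a metric_tensor \<Rightarrow> 'e \<Rightarrow> 'e \<Rightarrow> 'e \<Rightarrow> real" where
  "ricci c g \<equiv> ricci_local (metric_coord c g)"

abbreviation hessian ::
  "('a, 'e::euclidean_space) chart \<Rightarrow> 'a metric_tensor \<Rightarrow> ('a \<Rightarrow> real) \<Rightarrow> 'e \<Rightarrow> 'e \<Rightarrow> 'e \<Rightarrow> real" where
  "hessian c g f \<equiv> hessian_local (metric_coord c g) (f \<circ> chart_inv c)"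

abbreviation lie_deriv ::
  "('a, 'e::euclidean_space) chart \<Rightarrow> 'a vfield \<Rightarrow> 'a metric_tensor \<Rightarrow> 'e \<Rightarrow> 'e \<Rightarrow> 'e \<Rightarrow> real" where
  "lie_deriv c X g \<equiv> lie_local (vfield_coord c X) (metric_coord c g)"

text \<open>The scalar curvature at \<open>p\<close> can be computed in any chart around \<open>p\<close>.\<close>

definition scalar_curvature ::
  "('a, 'e::euclidean_space) chart set \<Rightarrow> 'a metric_tensor \<Rightarrow> 'a \<Rightarrow> real" where
  "scalar_curvature A g p =
     (let c = (SOME c. c \<in> A \<and> p \<in> chart_dom c) in scalar_local (metric_coord c g) (chart_map c p))"

definition hessian_proportional ::
  "('a, 'e::euclidean_space) chart set \<Rightarrow> 'a metric_tensor \<Rightarrow> ('a \<Rightarrow> real) \<Rightarrow> ('a \<Rightarrow> real) \<Rightarrow> bool" where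
  "hessian_proportional A g f \<sigma> \<longleftrightarrow>
     (\<forall>c\<in>A. \<forall>p\<in>chart_dom c. \<forall>a b.
        hessian c g f (chart_map c p) a b = \<sigma> p * metric_coord c g (chart_map c p) a b)"

definition killing :: "('a, 'e::euclidean_space) chart set \<Rightarrow> 'a metric_tensor \<Rightarrow> 'a vfield \<Rightarrow> bool" where
  "killing A g X \<longleftrightarrow>
     (\<forall>c\<in>A. \<forall>p\<in>chart_dom c. \<forall>a b. lie_deriv c X g (chart_map c p) a b = 0)"

definition einstein ::
  "('a::topological_space, 'e::euclidean_space) chart set \<Rightarrow> 'a metric_tensor \<Rightarrow> bool" where
  "einstein A g \<longleftrightarrow>
     (\<exists>\<mu>. smooth_fun A \<mu> \<and>
        (\<forall>c\<in>A. \<forall>p\<in>chart_dom c. \<forall>a b.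
           ricci c g (chart_map c p) a b = \<mu> p * metric_coord c g (chart_map c p) a b))"

definition ricci_bourguignon_soliton ::
  "('a::topological_space, 'e::euclidean_space) chart set \<Rightarrow> 'a metric_tensor \<Rightarrow> 'a vfield \<Rightarrow>
   real \<Rightarrow> real \<Rightarrow> bool" where
  "ricci_bourguignon_soliton A g X l \<rho> \<longleftrightarrow>
     semi_riemannian A g \<and> smooth_vfield A X \<and>
     (\<forall>c\<in>A. \<forall>p\<in>chart_dom c. \<forall>a b.
        ricci c g (chart_map c p) a b + 1 / 2 * lie_deriv c X g (chart_map c p) a b =
        l * metric_coord c g (chart_map c p) a b +
        \<rho> * scalar_curvature A g p * metric_coord c g (chart_map c p) a b)"

end

theory Submission
  imports Defs
begin

text \<open>
  Since \<open>X\<close> is Killing, the soliton equation says that \<open>Ric = \<Lambda> g\<close> for a function \<open>\<Lambda>\<close>.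
  For a warped product \<open>B \<times>\<^sub>h F\<close> with \<open>n = dim F\<close>, the Ricci tensor is
  \<open>Ric\<^sub>B - (n/h) Hess h\<close> on vectors tangent to \<open>B\<close> and
  \<open>Ric\<^sub>F - (h \<Delta>h + (n - 1) |grad h|\<^sup>2) g\<^sub>F\<close> on vectors tangent to \<open>F\<close>. Hence \<open>Ric = \<Lambda> g\<close> always passes
  to the fibre, and passes to the base if \<open>Hess h\<close> is proportional to the metric. Applied to
  \<open>(M\<^sub>1 \<times> M\<^sub>2) \<times>\<^sub>h M\<^sub>3\<close> and then to \<open>M\<^sub>1 \<times>\<^sub>f M\<^sub>2\<close>, this gives the three claims; the Hessian of \<open>f\<close> on \<open>M\<close>
  restricts to the one on \<open>M\<^sub>1\<close>. On a factor, the resulting \<open>\<mu>\<close> is a quotient of components of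
  \<open>Ric\<close> and of the metric near each point, so it is smooth.
\<close>

subsection \<open>Smooth maps\<close>

lemma Ck_on_cong:
  assumes "open S" "\<And>x. x \<in> S \<Longrightarrow> F x = G x" "Ck_on k S F"
  shows "Ck_on k S G"
  using assms(2,3)
proof (induction k arbitrary: F G)
  case 0
  then show ?case by (simp cong: continuous_on_cong)
next
  case (Suc k)
  have "pd v F x = pd v G x" if "x \<in> S" for v x
    using frechet_derivative_transform_within_open[of F x S G] Suc.prems that assms(1) by simp
  then have "Ck_on k S (\<lambda>x. pd v G x)" for v
    by (rule Suc.IH[of "\<lambda>x. pd v F x"]) (use Suc.prems(2) in simp_all)
  moreover have "G differentiable (at x)" if "x \<in> S" for x
  proof -
    have "F differentiable (at x)" using Suc.prems(2) that by simp
    then obtain F' where "(F has_derivative F') (at x)"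
      unfolding differentiable_def by (rule exE)
    then have "(G has_derivative F') (at x)"
      by (rule has_derivative_transform_within_open[OF _ assms(1) that]) (rule Suc.prems(1))
    then show ?thesis by (rule differentiableI)
  qed
  ultimately show ?case by simp
qed

lemma Ck_on_SucD: "Ck_on (Suc k) S F \<Longrightarrow> Ck_on k S F"
proof (induction k arbitrary: F)
  case 0
  then show ?case
    by (auto intro!: continuous_at_imp_continuous_on differentiable_imp_continuous_within)
next
  case (Suc k)
  then show ?case by (metis Ck_on.simps(2))
qed

lemma Ck_on_imp_continuous_on: "Ck_on k S F \<Longrightarrow> continuous_on S F"
  by (induction k) (auto simp del: Ck_on.simps(2) dest: Ck_on_SucD)

lemma Ck_on_const: "Ck_on k S (\<lambda>x. c)"
  by (induction k arbitrary: c) auto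

lemma Ck_on_Suc_has_derivative:
  "\<lbrakk>Ck_on (Suc k) S F; x \<in> S\<rbrakk> \<Longrightarrow> (F has_derivative (\<lambda>v. pd v F x)) (at x)"
  using frechet_derivative_works by auto

lemma Ck_on_Suc_pd: "Ck_on (Suc k) S F \<Longrightarrow> Ck_on k S (\<lambda>x. pd v F x)"
  by simp

lemma pd_eqI: "(F has_derivative F') (at x) \<Longrightarrow> pd a F x = F' a"
  using frechet_derivative_at[of F F' x] by simp

text \<open>Replaces the chosen \<open>frechet_derivative\<close> by any explicit derivative
  formula. Each closure property below then reduces to a differentiation rule plus the induction
  hypothesis.\<close>

lemma Ck_on_SucI:
  assumes "open S" "\<And>x. x \<in> S \<Longrightarrow> (F has_derivative F' x) (at x)"
    and "\<And>v. Ck_on k S (\<lambda>x. F' x v)"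
  shows "Ck_on (Suc k) S F"
proof -
  have "Ck_on k S (\<lambda>x. pd v F x)" for v
    by (rule Ck_on_cong[OF assms(1) _ assms(3)[of v]]) (simp add: pd_eqI[OF assms(2)])
  moreover have "\<forall>x\<in>S. F differentiable (at x)"
    using assms(2) unfolding differentiable_def by blast
  ultimately show ?thesis by simp
qed

lemma Ck_on_linear:
  assumes "bounded_linear L" "open S" "Ck_on k S F"
  shows "Ck_on k S (\<lambda>x. L (F x))"
  using assms(3)
proof (induction k arbitrary: F)
  case 0
  then show ?case by (simp add: bounded_linear.continuous_on[OF assms(1)])
next
  case (Suc k)
  show ?case
    by (rule Ck_on_SucI[OF assms(2)])
      (rule bounded_linear.has_derivative[OF assms(1) Ck_on_Suc_has_derivative[OF Suc.prems]],
       assumption, rule Suc.IH[OF Ck_on_Suc_pd[OF Suc.prems]])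
qed

lemma Ck_on_add:
  assumes "open S" "Ck_on k S F" "Ck_on k S G"
  shows "Ck_on k S (\<lambda>x. F x + G x)"
  using assms(2,3)
proof (induction k arbitrary: F G)
  case 0
  then show ?case by (simp add: continuous_on_add)
next
  case (Suc k)
  note d = Suc.prems[THEN Ck_on_Suc_has_derivative]
  show ?case
    by (rule Ck_on_SucI[OF assms(1) has_derivative_add[OF d]])
      (auto intro: Suc.IH Suc.prems[THEN Ck_on_Suc_pd])
qed

text \<open>The product rule yields two terms, each pairing one map with a derivative of the other.
  Both are of class C^k by the induction hypothesis, which is why the induction runs over all pairs
  of maps.\<close>

lemma Ck_on_bilinear:
  assumes "bounded_bilinear B" "open S" "Ck_on k S F" "Ck_on k S G"
  shows "Ck_on k S (\<lambda>x. B (F x) (G x))"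
  using assms(3,4)
proof (induction k arbitrary: F G)
  case 0
  then show ?case by (simp add: bounded_bilinear.continuous_on[OF assms(1)])
next
  case (Suc k)
  note d = Suc.prems[THEN Ck_on_Suc_has_derivative]
  show ?case
    by (rule Ck_on_SucI[OF assms(2) bounded_bilinear.FDERIV[OF assms(1) d]])
      (auto intro!: Ck_on_add[OF assms(2)] Suc.IH Suc.prems[THEN Ck_on_Suc_pd]
        Suc.prems[THEN Ck_on_SucD])
qed

text \<open>The derivative is minus \<open>inverse (F x)\<close> times the derivative of
  \<open>F\<close> times \<open>inverse (F x)\<close>. Only the same inverse recurs, one order
  lower, so \<open>F\<close> stays fixed in the induction.\<close>

lemma Ck_on_inverse:
  fixes F :: "'e::euclidean_space \<Rightarrow> real"
  assumes "open S" "Ck_on k S F" "\<And>x. x \<in> S \<Longrightarrow> F x \<noteq> 0"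
  shows "Ck_on k S (\<lambda>x. inverse (F x))"
  using assms(2)
proof (induction k)
  case 0
  then show ?case using assms(3) by (simp add: continuous_on_inverse)
next
  case (Suc k)
  note d = Ck_on_Suc_has_derivative[OF Suc.prems]
  have IH: "Ck_on k S (\<lambda>x. inverse (F x))"
    using Suc.IH Ck_on_SucD[OF Suc.prems] by simp
  show ?case
    by (rule Ck_on_SucI[OF assms(1) Deriv.has_derivative_inverse[OF assms(3) d]])
      (auto intro!: Ck_on_linear[of uminus] bounded_linear_minus bounded_linear_ident
        Ck_on_bilinear[OF bounded_bilinear_mult] IH assms(1) Ck_on_Suc_pd[OF Suc.prems])
qed

text \<open>Serves to lift functions along the projections of a product and, with \<open>L\<close>
  the identity, to restrict them to a smaller open set.\<close>

lemma Ck_on_comp_linear: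
  assumes "bounded_linear L" "open T" "L ` T \<subseteq> S" "Ck_on k S F"
  shows "Ck_on k T (\<lambda>x. F (L x))"
  using assms(4)
proof (induction k arbitrary: F)
  case 0
  then show ?case using assms(3)
    by (auto intro: continuous_on_compose2[OF _ linear_continuous_on[OF assms(1)]])
next
  case (Suc k)
  have "((\<lambda>x. F (L x)) has_derivative (\<lambda>v. pd (L v) F (L x))) (at x)" if "x \<in> T" for x
  proof (rule has_derivative_compose[of L L])
    show "(L has_derivative L) (at x)" by (rule bounded_linear_imp_has_derivative[OF assms(1)])
    show "(F has_derivative (\<lambda>v. pd v F (L x))) (at (L x))"
      using Ck_on_Suc_has_derivative[OF Suc.prems] that assms(3) by blast
  qed
  then show ?case
    by (rule Ck_on_SucI[OF assms(2)]) (assumption, rule Suc.IH[OF Ck_on_Suc_pd[OF Suc.prems]])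
qed

lemma Ck_on_local:
  assumes "\<And>x. x \<in> S \<Longrightarrow> \<exists>U. open U \<and> x \<in> U \<and> Ck_on k U F"
  shows "Ck_on k S F"
  using assms
proof (induction k arbitrary: F)
  case 0
  then show ?case
    by (metis Ck_on.simps(1) continuous_at_imp_continuous_on continuous_on_eq_continuous_at)
next
  case (Suc k)
  then show ?case
    by (metis Ck_on.simps(2))
qed

section \<open>The same closure properties for smooth maps\<close>

lemma smooth_on_cong:
  "\<lbrakk>open S; \<And>x. x \<in> S \<Longrightarrow> F x = G x; smooth_on S F\<rbrakk> \<Longrightarrow> smooth_on S G"
  unfolding smooth_on_def by (blast intro: Ck_on_cong[of S F G])

lemma smooth_on_const: "smooth_on S (\<lambda>x. c)"
  by (simp add: smooth_on_def Ck_on_const)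

lemma smooth_on_linear:
  "\<lbrakk>bounded_linear L; open S; smooth_on S F\<rbrakk> \<Longrightarrow> smooth_on S (\<lambda>x. L (F x))"
  unfolding smooth_on_def by (blast intro: Ck_on_linear[of L S _ F])

lemma smooth_on_add:
  "\<lbrakk>open S; smooth_on S F; smooth_on S G\<rbrakk> \<Longrightarrow> smooth_on S (\<lambda>x. F x + G x)"
  unfolding smooth_on_def by (blast intro: Ck_on_add[of S _ F G])

lemma smooth_on_diff:
  "\<lbrakk>open S; smooth_on S F; smooth_on S G\<rbrakk> \<Longrightarrow> smooth_on S (\<lambda>x. F x - G x)"
  using smooth_on_add[of S F "\<lambda>x. - G x"] smooth_on_linear[of uminus S G]
  by (simp add: bounded_linear_minus)

lemma smooth_on_bilinear:
  "\<lbrakk>bounded_bilinear B; open S; smooth_on S F; smooth_on S G\<rbrakk> \<Longrightarrow> smooth_on S (\<lambda>x. B (F x) (G x))"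
  unfolding smooth_on_def by (blast intro: Ck_on_bilinear[of B S _ F G])

lemmas smooth_on_mult = smooth_on_bilinear[OF bounded_bilinear_mult]
lemmas smooth_on_scaleR = smooth_on_bilinear[OF bounded_bilinear_scaleR]

lemma smooth_on_sum:
  assumes "open S" "\<And>i. i \<in> I \<Longrightarrow> smooth_on S (F i)"
  shows "smooth_on S (\<lambda>x. \<Sum>i\<in>I. F i x)"
  using assms(2)
  by (induction I rule: infinite_finite_induct) (auto intro: smooth_on_const smooth_on_add assms(1))

lemma smooth_on_divide:
  fixes F G :: "'e::euclidean_space \<Rightarrow> real"
  assumes "open S" "smooth_on S F" "smooth_on S G" "\<And>x. x \<in> S \<Longrightarrow> G x \<noteq> 0"
  shows "smooth_on S (\<lambda>x. F x / G x)"
proof -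
  have "smooth_on S (\<lambda>x. inverse (G x))"
    using assms unfolding smooth_on_def by (auto intro: Ck_on_inverse[of S _ G])
  then show ?thesis
    using smooth_on_mult[of S F "\<lambda>x. inverse (G x)"] assms by (simp add: divide_inverse)
qed

lemma smooth_on_comp_linear:
  "\<lbrakk>bounded_linear L; open T; L ` T \<subseteq> S; smooth_on S F\<rbrakk> \<Longrightarrow> smooth_on T (\<lambda>x. F (L x))"
  unfolding smooth_on_def by (blast intro: Ck_on_comp_linear[of L T S _ F])

lemma smooth_on_pd: "smooth_on S F \<Longrightarrow> smooth_on S (\<lambda>x. pd a F x)"
  unfolding smooth_on_def by (intro allI Ck_on_Suc_pd) (rule spec)

lemma smooth_on_has_derivative:
  "\<lbrakk>smooth_on S F; x \<in> S\<rbrakk> \<Longrightarrow> (F has_derivative (\<lambda>a. pd a F x)) (at x)"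
  unfolding smooth_on_def by (rule Ck_on_Suc_has_derivative) (rule spec)

lemma smooth_on_local:
  assumes "\<And>x. x \<in> S \<Longrightarrow> \<exists>U. open U \<and> x \<in> U \<and> smooth_on U F"
  shows "smooth_on S F"
  unfolding smooth_on_def
proof
  fix k show "Ck_on k S F"
    by (rule Ck_on_local) (use assms in \<open>auto simp: smooth_on_def\<close>)
qed

subsection \<open>Metrics on open sets\<close>

text \<open>Additivity and homogeneity in the vector hold at every point of an open neighbourhood,
  so these identities can be differentiated with respect to the point.\<close>

lemma linear_pd_param:
  assumes "open S" "x \<in> S" "\<And>y. y \<in> S \<Longrightarrow> linear (l y)"
    and d: "\<And>w. ((\<lambda>y. l y w) has_derivative (\<lambda>a. pd a (\<lambda>y. l y w) x)) (at x)"
  shows "linear (\<lambda>w. pd a (\<lambda>y. l y w) x)"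
proof (rule linearI)
  fix v w
  have "((\<lambda>y. l y (v + w)) has_derivative (\<lambda>a. pd a (\<lambda>y. l y v) x + pd a (\<lambda>y. l y w) x)) (at x)"
    by (rule has_derivative_transform_within_open[OF has_derivative_add[OF d d] assms(1,2)])
      (simp add: linear_add assms(3))
  then show "pd a (\<lambda>y. l y (v + w)) x = pd a (\<lambda>y. l y v) x + pd a (\<lambda>y. l y w) x"
    by (rule pd_eqI)
next
  fix r v
  have "((\<lambda>y. l y (r *\<^sub>R v)) has_derivative (\<lambda>a. r *\<^sub>R pd a (\<lambda>y. l y v) x)) (at x)"
    by (rule has_derivative_transform_within_open[OF has_derivative_scaleR_right[OF d] assms(1,2)])
      (simp add: linear_cmul assms(3))
  then show "pd a (\<lambda>y. l y (r *\<^sub>R v)) x = r *\<^sub>R pd a (\<lambda>y. l y v) x"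
    by (rule pd_eqI)
qed

text \<open>The Christoffel symbols of the first kind: the metric pairing of the covariant
  derivative of \<open>b\<close> along \<open>a\<close> with \<open>w\<close>, for constant
  coordinate fields.\<close>

definition koszul :: "('e::euclidean_space \<Rightarrow> 'e \<Rightarrow> 'e \<Rightarrow> real) \<Rightarrow> 'e \<Rightarrow> 'e \<Rightarrow> 'e \<Rightarrow> 'e \<Rightarrow> real" where
  "koszul G x a b w =
     (pd a (\<lambda>y. G y b w) x + pd b (\<lambda>y. G y a w) x - pd w (\<lambda>y. G y a b) x) / 2"

lemma christoffel_koszul: "christoffel G x a b = sharp G x (koszul G x a b)"
  by (simp add: christoffel_def koszul_def[abs_def])

locale local_metric =
  fixes S :: "'e::euclidean_space set" and G :: "'e \<Rightarrow> 'e \<Rightarrow> 'e \<Rightarrow> real"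
  assumes open_S: "open S"
    and smooth: "smooth_on S (\<lambda>x. G x u w)"
    and bilinear: "x \<in> S \<Longrightarrow> bilinear (G x)"
    and sym: "x \<in> S \<Longrightarrow> G x u w = G x w u"
    and nondegenerate: "x \<in> S \<Longrightarrow> (\<And>w. G x u w = 0) \<Longrightarrow> u = 0"
begin

section \<open>Lowering and raising indices\<close>

lemma linear_left: "x \<in> S \<Longrightarrow> linear (\<lambda>u. G x u w)"
  and linear_right: "x \<in> S \<Longrightarrow> linear (G x u)"
  using bilinear by (auto simp: bilinear_def)

lemma expand_left: "x \<in> S \<Longrightarrow> G x v w = (\<Sum>j\<in>Basis. (v \<bullet> j) * G x j w)"
  using linear_sum[OF linear_left, of x "\<lambda>j. (v \<bullet> j) *\<^sub>R j" Basis w]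
  by (simp add: euclidean_representation linear_cmul[OF linear_left])

lemma eqI_Basis:
  assumes "x \<in> S" "linear l" "\<And>i. i \<in> Basis \<Longrightarrow> G x v i = l i"
  shows "G x v w = l w"
  using linear_eq_stdbasis[OF linear_right[OF assms(1)] assms(2,3)] by metis

lemma unique: "\<lbrakk>x \<in> S; \<And>w. G x u w = G x v w\<rbrakk> \<Longrightarrow> u = v"
  using nondegenerate[of x "u - v"] by (simp add: linear_diff[OF linear_left])

text \<open>The linear form metrically equivalent to \<open>v\<close> is represented by a vector
  through the Euclidean inner product of the model space. Lowering an index thus becomes an
  endomorphism of \<open>'e\<close>.\<close>

definition flat :: "'e \<Rightarrow> 'e \<Rightarrow> 'e" where
  "flat x v = (\<Sum>i\<in>Basis. G x v i *\<^sub>R i)"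

lemma inner_flat: "x \<in> S \<Longrightarrow> flat x v \<bullet> w = G x v w"
proof -
  assume x: "x \<in> S"
  have "linear (\<lambda>w. flat x v \<bullet> w)"
    by (intro bounded_linear.linear bounded_linear_inner_right)
  from eqI_Basis[OF x this, of v w] show "flat x v \<bullet> w = G x v w"
    by (simp add: flat_def)
qed

lemma linear_flat: "x \<in> S \<Longrightarrow> linear (flat x)"
  by (rule linearI; rule euclidean_eqI)
    (simp_all add: inner_flat inner_add_left linear_add[OF linear_left] linear_cmul[OF linear_left])

text \<open>Nondegeneracy makes \<open>flat x\<close> injective, and an injective endomorphism of a
  finite-dimensional space is surjective.\<close>

lemma sharp_exists:
  assumes "x \<in> S" "linear l"
  shows "\<exists>v. \<forall>w. G x v w = l w"
proof -
  have "inj (flat x)"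
  proof (rule injI)
    fix u v assume "flat x u = flat x v"
    then show "u = v" using unique[OF assms(1)] inner_flat[OF assms(1)] by metis
  qed
  then have "surj (flat x)"
    using linear_flat[OF assms(1)] linear_injective_imp_surjective by blast
  then obtain v where v: "(\<Sum>i\<in>Basis. l i *\<^sub>R i) = flat x v" by (rule surjE)
  have "G x v i = l i" if "i \<in> Basis" for i
    using that by (simp add: inner_flat[OF assms(1), symmetric] v[symmetric])
  then show ?thesis using eqI_Basis[OF assms] by blast
qed

lemma sharp_eqI: "\<lbrakk>x \<in> S; \<And>w. G x v w = l w\<rbrakk> \<Longrightarrow> sharp G x l = v"
  unfolding sharp_def by (rule the_equality) (auto intro: unique)

lemma sharp_works: "\<lbrakk>x \<in> S; linear l\<rbrakk> \<Longrightarrow> G x (sharp G x l) w = l w"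
  using sharp_exists sharp_eqI by metis

lemma flat_sharp: "x \<in> S \<Longrightarrow> flat x (sharp G x (\<lambda>w. u \<bullet> w)) = u"
  by (rule euclidean_eqI)
    (simp add: inner_flat sharp_works bounded_linear.linear bounded_linear_inner_right)

text \<open>Smooth dependence of \<open>sharp\<close> on the point is the inverse function theorem for the
  bundle map \<open>(x, v) \<mapsto> (x, flat x v)\<close>.\<close>

lemma differentiable_sharp_inner:
  assumes x0: "x0 \<in> S"
  shows "(\<lambda>z. sharp G (fst z) (\<lambda>w. snd z \<bullet> w)) differentiable (at (x0, u0))"
proof -
  define \<Phi> where "\<Phi> z = (fst z, flat (fst z) (snd z))" for z
  define \<Psi> where "\<Psi> z = (fst z, sharp G (fst z) (\<lambda>w. snd z \<bullet> w))" for z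
  \<comment> \<open>\<open>D x v a\<close> is the derivative of \<open>flat\<close> in the base
    point alone. The derivative \<Phi>' is therefore block triangular, with \<open>flat x\<close> as
    the block acting on the fibre.\<close>
  define D where "D x v a = (\<Sum>i\<in>Basis. (\<Sum>j\<in>Basis. (v \<bullet> j) * pd a (\<lambda>y. G y j i) x) *\<^sub>R i)"
    for x v a :: 'e
  define \<Phi>' where "\<Phi>' x v z = (fst z, D x v (fst z) + flat x (snd z))" for x v z
  have der: "(\<Phi> has_derivative \<Phi>' x v) (at (x, v))" if x: "x \<in> S" for x v
  proof -
    have G: "((\<lambda>z. G (fst z) j i) has_derivative (\<lambda>h. pd (fst h) (\<lambda>y. G y j i) x)) (at (x, v))"
      for i j
      using has_derivative_compose[OF has_derivative_fst[OF has_derivative_ident], of "\<lambda>y. G y j i" _ "(x, v)"]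
        smooth_on_has_derivative[OF smooth x] by auto
    have "((\<lambda>z. (fst z, \<Sum>i\<in>Basis. (\<Sum>j\<in>Basis. (snd z \<bullet> j) * G (fst z) j i) *\<^sub>R i)) has_derivative
       (\<lambda>h. (fst h, \<Sum>i\<in>Basis. (\<Sum>j\<in>Basis. (v \<bullet> j) * pd (fst h) (\<lambda>y. G y j i) x
                 + (snd h \<bullet> j) * G x j i) *\<^sub>R i))) (at (x, v))"
      by (auto intro!: derivative_eq_intros G)
    moreover have "\<Phi>' x v = (\<lambda>h. (fst h, \<Sum>i\<in>Basis. (\<Sum>j\<in>Basis. (v \<bullet> j) * pd (fst h) (\<lambda>y. G y j i) x
                 + (snd h \<bullet> j) * G x j i) *\<^sub>R i))"
      by (simp add: fun_eq_iff \<Phi>'_def D_def flat_def expand_left[OF x, symmetric] sum.distrib scaleR_add_left)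
    ultimately have "((\<lambda>z. (fst z, \<Sum>i\<in>Basis. (\<Sum>j\<in>Basis. (snd z \<bullet> j) * G (fst z) j i) *\<^sub>R i)) has_derivative
       \<Phi>' x v) (at (x, v))" by simp
    then show ?thesis
    proof (rule has_derivative_transform_within_open)
      show "open (S \<times> (UNIV :: 'e set))" by (simp add: open_Times open_S)
    qed (use x in \<open>auto simp: \<Phi>_def flat_def expand_left[symmetric]\<close>)
  qed
  \<comment> \<open>The derivative claimed for \<Psi> comes from solving the triangular system: the
    first component is kept, and the second is \<open>sharp\<close> of what remains after
    subtracting the \<open>D\<close> term.\<close>
  have "(\<Psi> has_derivative (\<lambda>z. (fst z, sharp G x0 (\<lambda>w. (snd z - D x0 (snd (\<Psi> (x0, u0))) (fst z)) \<bullet> w))))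
    (at (x0, u0))"
  proof (rule has_derivative_inverse_strong_x)
    show "open (S \<times> (UNIV :: 'e set))" by (simp add: open_Times open_S)
    show "\<Psi> (x0, u0) \<in> S \<times> UNIV" using x0 by (simp add: \<Psi>_def)
    show "continuous_on (S \<times> UNIV) \<Phi>"
      using der by (intro continuous_at_imp_continuous_on) (auto dest: has_derivative_continuous)
    show "\<Psi> (\<Phi> z) = z" if "z \<in> S \<times> UNIV" for z
      using that by (auto simp: \<Psi>_def \<Phi>_def inner_flat intro!: sharp_eqI)
    show "(\<Phi> has_derivative \<Phi>' x0 (snd (\<Psi> (x0, u0)))) (at (\<Psi> (x0, u0)))"
      using der[OF x0] by (simp add: \<Psi>_def)
    show "\<Phi> (\<Psi> (x0, u0)) = (x0, u0)"
      using x0 by (simp add: \<Psi>_def \<Phi>_def flat_sharp)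
  qed (auto simp: fun_eq_iff \<Phi>'_def flat_sharp[OF x0])
  then have "(\<lambda>z. snd (\<Psi> z)) differentiable (at (x0, u0))"
    using has_derivative_snd unfolding differentiable_def by blast
  then show ?thesis by (simp add: \<Psi>_def)
qed

text \<open>A linear form is the inner product with the vector of its values on
  \<open>Basis\<close>. A family of forms thereby becomes a map into the model space, to which
  \<open>differentiable_sharp_inner\<close> applies.\<close>

lemma sharp_eq_sharp_inner:
  assumes "x \<in> S" "linear (l x)"
  shows "sharp G x (l x) = sharp G x (\<lambda>w. (\<Sum>i\<in>Basis. l x i *\<^sub>R i) \<bullet> w)"
proof (rule arg_cong[of "l x"])
  have "linear (\<lambda>w. (\<Sum>i\<in>Basis. l x i *\<^sub>R i) \<bullet> w)"
    by (intro bounded_linear.linear bounded_linear_inner_right)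
  then show "l x = (\<lambda>w. (\<Sum>i\<in>Basis. l x i *\<^sub>R i) \<bullet> w)"
    by (rule linear_eq_stdbasis[OF assms(2)]) simp
qed

text \<open>Differentiability follows from the chain rule. The formula then results from
  differentiating \<open>G y (v y) w = l y w\<close> and solving for the derivative of
  \<open>v\<close>; the sum is the derivative of the metric with its first argument frozen at
  \<open>v x\<close>.\<close>

lemma has_derivative_sharp:
  assumes lin: "\<And>y. y \<in> S \<Longrightarrow> linear (l y)" and x: "x \<in> S"
    and l: "\<And>w. ((\<lambda>y. l y w) has_derivative (\<lambda>a. pd a (\<lambda>y. l y w) x)) (at x)"
  shows "((\<lambda>y. sharp G y (l y)) has_derivative
    (\<lambda>a. sharp G x (\<lambda>w. pd a (\<lambda>y. l y w) x -
       (\<Sum>j\<in>Basis. (sharp G x (l x) \<bullet> j) * pd a (\<lambda>y. G y j w) x)))) (at x)"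
proof -
  define v where "v y = sharp G y (l y)" for y
  let ?u = "\<lambda>y. \<Sum>i\<in>Basis. l y i *\<^sub>R i"
  obtain P where P: "((\<lambda>z. sharp G (fst z) (\<lambda>w. snd z \<bullet> w)) has_derivative P) (at (x, ?u x))"
    using differentiable_sharp_inner[OF x] by (auto simp: differentiable_def)
  have "((\<lambda>y. (y, ?u y)) has_derivative (\<lambda>a. (a, \<Sum>i\<in>Basis. pd a (\<lambda>y. l y i) x *\<^sub>R i))) (at x)"
    by (auto intro!: derivative_eq_intros l)
  from has_derivative_compose[OF this P]
  obtain v' where v': "((\<lambda>y. sharp G y (\<lambda>w. ?u y \<bullet> w)) has_derivative v') (at x)" by auto
  have v': "(v has_derivative v') (at x)"
    by (rule has_derivative_transform_within_open[OF v' open_S x])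
      (simp add: v_def sharp_eq_sharp_inner lin)
  have "v' a = sharp G x (\<lambda>w. pd a (\<lambda>y. l y w) x - (\<Sum>j\<in>Basis. (v x \<bullet> j) * pd a (\<lambda>y. G y j w) x))" for a
  proof (rule sharp_eqI[OF x, symmetric])
    fix w
    have "((\<lambda>y. \<Sum>j\<in>Basis. (v y \<bullet> j) * G y j w) has_derivative
        (\<lambda>a. \<Sum>j\<in>Basis. (v x \<bullet> j) * pd a (\<lambda>y. G y j w) x + (v' a \<bullet> j) * G x j w)) (at x)"
      by (auto intro!: derivative_eq_intros v' smooth_on_has_derivative[OF smooth x])
    then have "((\<lambda>y. l y w) has_derivative
        (\<lambda>a. \<Sum>j\<in>Basis. (v x \<bullet> j) * pd a (\<lambda>y. G y j w) x + (v' a \<bullet> j) * G x j w)) (at x)"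
      by (rule has_derivative_transform_within_open[OF _ open_S x])
        (simp add: expand_left[symmetric] v_def sharp_works lin)
    from pd_eqI[OF this, of a]
    show "G x (v' a) w = pd a (\<lambda>y. l y w) x - (\<Sum>j\<in>Basis. (v x \<bullet> j) * pd a (\<lambda>y. G y j w) x)"
      by (simp add: sum.distrib expand_left[OF x, symmetric])
  qed
  then have "v' = (\<lambda>a. sharp G x (\<lambda>w. pd a (\<lambda>y. l y w) x -
      (\<Sum>j\<in>Basis. (v x \<bullet> j) * pd a (\<lambda>y. G y j w) x)))" by (rule ext)
  with v' show ?thesis by (simp add: v_def[abs_def])
qed

text \<open>The derivative is again \<open>sharp\<close> of a family of linear forms, built from
  derivatives of \<open>l\<close> and \<open>G\<close> and from the undifferentiated
  \<open>sharp G x (l x)\<close>. An induction over all families \<open>l\<close> at once therefore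
  gains one order per step.\<close>

lemma Ck_on_sharp:
  assumes "\<And>y. y \<in> S \<Longrightarrow> linear (l y)" "\<And>w. Ck_on k S (\<lambda>x. l x w)"
  shows "Ck_on k S (\<lambda>x. sharp G x (l x))"
  using assms
proof (induction k arbitrary: l)
  case 0
  let ?g = "\<lambda>z. sharp G (fst z) (\<lambda>w. snd z \<bullet> w)"
  let ?u = "\<lambda>y. \<Sum>i\<in>Basis. l y i *\<^sub>R i"
  have "continuous_on (S \<times> UNIV) ?g"
    by (auto intro!: continuous_at_imp_continuous_on differentiable_imp_continuous_within
        differentiable_sharp_inner)
  moreover have "continuous_on S (\<lambda>y. (y, ?u y))"
    using 0(2) by (auto intro!: continuous_intros)
  ultimately have "continuous_on S (\<lambda>y. ?g (y, ?u y))"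
    by (rule continuous_on_compose2) auto
  then show ?case
    using sharp_eq_sharp_inner[of _ l] 0(1) by (simp cong: continuous_on_cong)
next
  case (Suc k)
  have v: "Ck_on k S (\<lambda>x. sharp G x (l x))"
    using Suc.IH[OF Suc.prems(1) Ck_on_SucD[OF Suc.prems(2)]] by simp
  note dl = Ck_on_Suc_has_derivative[OF Suc.prems(2)]
  have G: "Ck_on k S (\<lambda>x. pd a (\<lambda>y. G y j w) x)" for a j w
    using smooth_on_pd[OF smooth] unfolding smooth_on_def by blast
  show ?case
  proof (rule Ck_on_SucI[OF open_S has_derivative_sharp[OF Suc.prems(1) _ dl]])
    fix a
    let ?l = "\<lambda>x w. pd a (\<lambda>y. l y w) x - (\<Sum>j\<in>Basis. (sharp G x (l x) \<bullet> j) * pd a (\<lambda>y. G y j w) x)"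
    have sumC: "Ck_on k S (\<lambda>x. \<Sum>j\<in>I. (sharp G x (l x) \<bullet> j) * pd a (\<lambda>y. G y j w) x)" for w I
      by (induction I rule: infinite_finite_induct)
        (auto intro!: Ck_on_const Ck_on_add[OF open_S] Ck_on_bilinear[OF bounded_bilinear_mult open_S] G
          Ck_on_linear[OF bounded_linear_inner_left open_S] v)
    have C: "Ck_on k S (\<lambda>x. ?l x w)" for w
      unfolding diff_conv_add_uminus
      by (intro Ck_on_add open_S Ck_on_Suc_pd Suc.prems(2) Ck_on_linear[of uminus] sumC
        bounded_linear_minus bounded_linear_ident)
    have "linear (?l x)" if x: "x \<in> S" for x
    proof -
      have "linear (\<lambda>w. pd a (\<lambda>y. G y j w) x)" for j
        by (rule linear_pd_param[OF open_S x linear_right smooth_on_has_derivative[OF smooth x]])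
      then have "linear (\<lambda>w. (sharp G x (l x) \<bullet> j) * pd a (\<lambda>y. G y j w) x)" for j
        using linear_compose_scale_right[of "\<lambda>w. pd a (\<lambda>y. G y j w) x"] by simp
      then show ?thesis
        by (intro linear_compose_sub linear_compose_sum ballI
          linear_pd_param[OF open_S x Suc.prems(1) dl[OF x]])
    qed
    from Suc.IH[OF this C] show "Ck_on k S (\<lambda>x. sharp G x (?l x))" .
  qed auto
qed

lemma smooth_on_sharp:
  "\<lbrakk>\<And>y. y \<in> S \<Longrightarrow> linear (l y); \<And>w. smooth_on S (\<lambda>x. l x w)\<rbrakk>
    \<Longrightarrow> smooth_on S (\<lambda>x. sharp G x (l x))"
  unfolding smooth_on_def by (auto intro: Ck_on_sharp)

section \<open>Levi-Civita connection and Ricci tensor in coordinates\<close>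

lemma linear_koszul:
  assumes x: "x \<in> S"
  shows "linear (koszul G x a b)"
proof -
  have 1: "linear (\<lambda>w. pd a (\<lambda>y. G y b w) x)" for a b
    by (rule linear_pd_param[OF open_S x linear_right smooth_on_has_derivative[OF smooth x]])
  have 2: "linear (\<lambda>w. pd w (\<lambda>y. G y a b) x)"
    using smooth_on_has_derivative[OF smooth x] by (rule has_derivative_linear)
  have "linear (\<lambda>w. (1/2) *\<^sub>R (pd a (\<lambda>y. G y b w) x + pd b (\<lambda>y. G y a w) x - pd w (\<lambda>y. G y a b) x))"
    by (intro linear_compose_scale_right linear_compose_sub linear_compose_add 1 2)
  then show ?thesis by (simp add: koszul_def[abs_def])
qed

lemma smooth_on_koszul: "smooth_on S (\<lambda>x. koszul G x a b w)"
proof -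
  have "smooth_on S (\<lambda>x. (1/2) * (pd a (\<lambda>y. G y b w) x + pd b (\<lambda>y. G y a w) x - pd w (\<lambda>y. G y a b) x))"
    by (intro smooth_on_linear[OF bounded_linear_mult_right] smooth_on_diff smooth_on_add
       smooth_on_pd smooth open_S)
  then show ?thesis by (simp add: koszul_def[abs_def])
qed

lemma christoffel_works: "x \<in> S \<Longrightarrow> G x (christoffel G x a b) w = koszul G x a b w"
  by (simp add: christoffel_koszul sharp_works linear_koszul)

lemma christoffel_eqI:
  "\<lbrakk>x \<in> S; \<And>w. G x v w = koszul G x a b w\<rbrakk> \<Longrightarrow> christoffel G x a b = v"
  by (simp add: christoffel_koszul sharp_eqI)

lemma smooth_on_christoffel: "smooth_on S (\<lambda>x. christoffel G x a b)"
  unfolding christoffel_koszul by (intro smooth_on_sharp linear_koszul smooth_on_koszul)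

lemma koszul_swap: "x \<in> S \<Longrightarrow> koszul G x a b w = koszul G x b a w"
proof -
  assume x: "x \<in> S"
  have "((\<lambda>y. G y b a) has_derivative (\<lambda>w. pd w (\<lambda>y. G y a b) x)) (at x)"
    \<comment> \<open>In the rule that closes this step, \<open>sym\<close> is the symmetry of the
      metric assumed in the locale, not the symmetry of equality.\<close>
    by (rule has_derivative_transform_within_open[OF smooth_on_has_derivative[OF smooth x] open_S x])
      (rule sym)
  from pd_eqI[OF this, of w] show "koszul G x a b w = koszul G x b a w"
    by (simp add: koszul_def)
qed

lemma christoffel_swap: "x \<in> S \<Longrightarrow> christoffel G x a b = christoffel G x b a"
  by (rule christoffel_eqI) (simp_all add: christoffel_works koszul_swap)

lemma linear_koszul_right:
  assumes x: "x \<in> S"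
  shows "linear (\<lambda>b. koszul G x a b w)"
proof -
  have 1: "linear (\<lambda>b. pd v (\<lambda>y. G y b w) x)" for v w
    by (rule linear_pd_param[OF open_S x linear_left smooth_on_has_derivative[OF smooth x]])
  have 2: "linear (\<lambda>b. pd w (\<lambda>y. G y a b) x)"
    by (rule linear_pd_param[OF open_S x linear_right smooth_on_has_derivative[OF smooth x]])
  have 3: "linear (\<lambda>b. pd b (\<lambda>y. G y a w) x)"
    using smooth_on_has_derivative[OF smooth x] by (rule has_derivative_linear)
  have "linear (\<lambda>b. (1/2) *\<^sub>R (pd a (\<lambda>y. G y b w) x + pd b (\<lambda>y. G y a w) x - pd w (\<lambda>y. G y a b) x))"
    by (intro linear_compose_scale_right linear_compose_sub linear_compose_add 1 2 3)
  then show ?thesis by (simp add: koszul_def[abs_def])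
qed

lemma linear_christoffel:
  assumes x: "x \<in> S"
  shows "linear (christoffel G x a)"
  by (rule linearI; rule christoffel_eqI[OF x])
    (simp_all add: linear_add[OF linear_left[OF x]] linear_cmul[OF linear_left[OF x]]
      christoffel_works[OF x] linear_add[OF linear_koszul_right[OF x]]
      linear_cmul[OF linear_koszul_right[OF x]])

text \<open>The quadratic terms of \<open>riemann_local\<close> carry a Christoffel vector, which
  varies with the point, in the second slot. Expanding it in \<open>Basis\<close> reduces this to
  constant arguments.\<close>

lemma smooth_on_christoffel_field:
  assumes "smooth_on S V"
  shows "smooth_on S (\<lambda>x. christoffel G x a (V x))"
proof (rule smooth_on_cong[OF open_S])
  show "smooth_on S (\<lambda>x. \<Sum>j\<in>Basis. (V x \<bullet> j) *\<^sub>R christoffel G x a j)"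
    by (intro smooth_on_sum smooth_on_scaleR open_S smooth_on_christoffel
        smooth_on_linear[OF bounded_linear_inner_left] assms)
next
  fix x assume "x \<in> S"
  from linear_sum[OF linear_christoffel[OF this], of a "\<lambda>j. (V x \<bullet> j) *\<^sub>R j" Basis]
  show "(\<Sum>j\<in>Basis. (V x \<bullet> j) *\<^sub>R christoffel G x a j) = christoffel G x a (V x)"
    by (simp add: euclidean_representation linear_cmul[OF linear_christoffel[OF \<open>x \<in> S\<close>]])
qed

lemma smooth_on_ricci: "smooth_on S (\<lambda>x. ricci_local G x b z)"
  unfolding ricci_local_def riemann_local_def
  by (intro smooth_on_sum smooth_on_linear[OF bounded_linear_inner_left] smooth_on_diff
      smooth_on_add smooth_on_pd smooth_on_christoffel smooth_on_christoffel_field open_S)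

end

subsection \<open>Curvature of warped products\<close>

lemma pd_eq_zero:
  assumes "open S" "x \<in> S" "\<And>y. y \<in> S \<Longrightarrow> F y = 0"
  shows "pd c F x = 0"
proof (rule pd_eqI)
  show "(F has_derivative (\<lambda>c. 0)) (at x)"
    by (rule has_derivative_transform_within_open[OF has_derivative_const assms(1,2)])
      (simp add: assms(3))
qed

text \<open>The trace splits because \<open>Basis\<close> of a product type is the disjoint union of
  the two embedded bases.\<close>

lemma ricci_local_prod:
  fixes G :: "'d::euclidean_space \<times> 'e::euclidean_space \<Rightarrow> _"
  shows "ricci_local G p b z = (\<Sum>i\<in>Basis. riemann_local G p (i, 0) b z \<bullet> (i, 0)) +
    (\<Sum>i\<in>Basis. riemann_local G p (0, i) b z \<bullet> (0, i))"
proof -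
  have "inj_on (\<lambda>u. (u, 0 :: 'e)) (Basis :: 'd set)" "inj_on (\<lambda>u. (0 :: 'd, u)) (Basis :: 'e set)"
    by (auto intro!: inj_onI)
  then show ?thesis
    unfolding ricci_local_def Basis_prod_def
    by (subst sum.union_disjoint) (auto simp: sum.reindex)
qed

lemma smooth_on_linear_pd: "\<lbrakk>smooth_on S F; x \<in> S\<rbrakk> \<Longrightarrow> linear (\<lambda>a. pd a F x)"
  using smooth_on_has_derivative has_derivative_linear by blast

context local_metric
begin

lemma zero_left: "x \<in> S \<Longrightarrow> G x 0 w = 0"
  and zero_right: "x \<in> S \<Longrightarrow> G x w 0 = 0"
  by (simp_all add: linear_0[OF linear_left] linear_0[OF linear_right])

lemma christoffel_zero_right: "x \<in> S \<Longrightarrow> christoffel G x a 0 = 0"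
  by (simp add: linear_0[OF linear_christoffel])

lemma christoffel_zero_left: "x \<in> S \<Longrightarrow> christoffel G x 0 a = 0"
  by (simp add: christoffel_swap[of x 0] christoffel_zero_right)

text \<open>Clears the terms with a zero slot from the mixed components on a product. The functions
  are known to vanish on \<open>S\<close> only, so openness of \<open>S\<close> enters.\<close>

lemma pd_zero:
  assumes "x \<in> S"
  shows "pd c (\<lambda>y. G y 0 w) x = 0" "pd c (\<lambda>y. G y w 0) x = 0"
    "pd c (\<lambda>y. christoffel G y 0 w) x = 0" "pd c (\<lambda>y. christoffel G y w 0) x = 0"
  by (rule pd_eq_zero[OF open_S assms];
      simp add: zero_left zero_right christoffel_zero_left christoffel_zero_right)+

lemma pd_zero_direction:
  assumes "x \<in> S"
  shows "pd 0 (\<lambda>y. G y v w) x = 0" "pd 0 (\<lambda>y. christoffel G y v w) x = 0"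
  using linear_0[OF smooth_on_linear_pd[OF smooth assms]]
    linear_0[OF smooth_on_linear_pd[OF smooth_on_christoffel assms]] by auto

end

text \<open>\<open>G\<close> is a parameter constrained on \<open>B \<times> F\<close> only. It can
  thus be the coordinate expression of a metric in a product chart, about which nothing is known
  outside the chart image.\<close>

locale warped_local = base: local_metric B GB + fib: local_metric F GF
  for B :: "'d::euclidean_space set" and GB and F :: "'e::euclidean_space set" and GF +
  fixes h :: "'d \<Rightarrow> real" and G :: "'d \<times> 'e \<Rightarrow> 'd \<times> 'e \<Rightarrow> 'd \<times> 'e \<Rightarrow> real"
  assumes smooth_h: "smooth_on B h"
    and h_pos: "x \<in> B \<Longrightarrow> h x > 0"
    and G_eq: "x \<in> B \<Longrightarrow> y \<in> F \<Longrightarrow>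
      G (x, y) a b = GB x (fst a) (fst b) + (h x)\<^sup>2 * GF y (snd a) (snd b)"
begin

lemma open_BF: "open (B \<times> F)"
  by (simp add: open_Times base.open_S fib.open_S)

text \<open>Makes the warped metric available as the base of a further warped product. Nondegeneracy
  is tested on vectors tangent to a single factor; for the fibre this uses
  \<open>h x > 0\<close>.\<close>

sublocale total: local_metric "B \<times> F" G
proof
  show "open (B \<times> F)" by (rule open_BF)
next
  fix u w :: "'d \<times> 'e"
  have 1: "smooth_on (B \<times> F) (\<lambda>z. GB (fst z) (fst u) (fst w))"
    by (rule smooth_on_comp_linear[OF bounded_linear_fst open_BF _ base.smooth]) auto
  have 2: "smooth_on (B \<times> F) (\<lambda>z. GF (snd z) (snd u) (snd w))"
    by (rule smooth_on_comp_linear[OF bounded_linear_snd open_BF _ fib.smooth]) auto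
  have 3: "smooth_on (B \<times> F) (\<lambda>z. h (fst z))"
    by (rule smooth_on_comp_linear[OF bounded_linear_fst open_BF _ smooth_h]) auto
  have "smooth_on (B \<times> F) (\<lambda>z. GB (fst z) (fst u) (fst w) + (h (fst z))\<^sup>2 * GF (snd z) (snd u) (snd w))"
    unfolding power2_eq_square by (intro smooth_on_add smooth_on_mult 1 2 3 open_BF)
  then show "smooth_on (B \<times> F) (\<lambda>z. G z u w)"
    by (rule smooth_on_cong[OF open_BF, rotated]) (auto simp: G_eq)
next
  fix z assume "z \<in> B \<times> F"
  then obtain x y where z: "z = (x, y)" "x \<in> B" "y \<in> F" by auto
  note lin = linear_compose[OF linear_fst base.linear_left[OF z(2)], unfolded o_def]
    linear_compose[OF linear_fst base.linear_right[OF z(2)], unfolded o_def]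
    linear_compose[OF linear_snd fib.linear_left[OF z(3)], unfolded o_def]
    linear_compose[OF linear_snd fib.linear_right[OF z(3)], unfolded o_def]
    linear_compose_scale_right[where 'b=real, unfolded real_scaleR_def]
  have "linear (\<lambda>a. GB x (fst a) (fst b) + (h x)\<^sup>2 * GF y (snd a) (snd b))" for b
    by (intro linear_compose_add lin)
  moreover have "linear (\<lambda>b. GB x (fst a) (fst b) + (h x)\<^sup>2 * GF y (snd a) (snd b))" for a
    by (intro linear_compose_add lin)
  ultimately show "bilinear (G z)"
    by (simp add: bilinear_def z G_eq[OF z(2,3), abs_def])
  show "G z u w = G z w u" for u w
    using z by (simp add: G_eq base.sym[of x "fst u"] fib.sym[of y "snd u"])
  fix u assume *: "\<And>w. G z u w = 0"
  have "fst u = 0"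
    by (rule base.nondegenerate[OF z(2)])
      (use *[of "(w, 0)" for w] z in \<open>simp add: G_eq fib.zero_right\<close>)
  moreover have "snd u = 0"
    by (rule fib.nondegenerate[OF z(3)])
      (use *[of "(0, w)" for w] h_pos[OF z(2)] z in \<open>simp add: G_eq base.zero_right\<close>)
  ultimately show "u = 0" by (simp add: prod_eq_iff)
qed

lemma has_derivative_fst_comp:
  "\<lbrakk>smooth_on B f; x \<in> B\<rbrakk> \<Longrightarrow> ((\<lambda>z. f (fst z)) has_derivative (\<lambda>a. pd (fst a) f x)) (at (x, y))"
  using has_derivative_compose[OF has_derivative_fst[OF has_derivative_ident], of f _ "(x, y)"]
    smooth_on_has_derivative[of B f x] by auto

lemma has_derivative_snd_comp:
  "\<lbrakk>smooth_on F f; y \<in> F\<rbrakk> \<Longrightarrow> ((\<lambda>z. f (snd z)) has_derivative (\<lambda>a. pd (snd a) f y)) (at (x, y))"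
  using has_derivative_compose[OF has_derivative_snd[OF has_derivative_ident], of f _ "(x, y)"]
    smooth_on_has_derivative[of F f y] by auto

lemma pd_G:
  assumes "x \<in> B" "y \<in> F"
  shows "pd a (\<lambda>z. G z b w) (x, y) = pd (fst a) (\<lambda>x. GB x (fst b) (fst w)) x
     + (2 * h x * pd (fst a) h x * GF y (snd b) (snd w)
     + (h x)\<^sup>2 * pd (snd a) (\<lambda>y. GF y (snd b) (snd w)) y)"
proof -
  have "((\<lambda>z. GB (fst z) (fst b) (fst w) + (h (fst z))\<^sup>2 * GF (snd z) (snd b) (snd w)) has_derivative
     (\<lambda>a. pd (fst a) (\<lambda>x. GB x (fst b) (fst w)) x
     + (2 * h x * pd (fst a) h x * GF y (snd b) (snd w)
     + (h x)\<^sup>2 * pd (snd a) (\<lambda>y. GF y (snd b) (snd w)) y))) (at (x, y))"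
    by (auto intro!: derivative_eq_intros has_derivative_fst_comp[OF base.smooth assms(1)]
       has_derivative_snd_comp[OF fib.smooth assms(2)] has_derivative_fst_comp[OF smooth_h assms(1)])
  then have "((\<lambda>z. G z b w) has_derivative
     (\<lambda>a. pd (fst a) (\<lambda>x. GB x (fst b) (fst w)) x
     + (2 * h x * pd (fst a) h x * GF y (snd b) (snd w)
     + (h x)\<^sup>2 * pd (snd a) (\<lambda>y. GF y (snd b) (snd w)) y))) (at (x, y))"
    by (rule has_derivative_transform_within_open[OF _ open_BF]) (use assms in \<open>auto simp: G_eq\<close>)
  then show ?thesis by (rule pd_eqI)
qed

lemma koszul_eq:
  assumes "x \<in> B" "y \<in> F"
  shows "koszul G (x, y) a b w = koszul GB x (fst a) (fst b) (fst w)
    + (h x)\<^sup>2 * koszul GF y (snd a) (snd b) (snd w)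
    + h x * (pd (fst a) h x * GF y (snd b) (snd w) + pd (fst b) h x * GF y (snd a) (snd w)
             - pd (fst w) h x * GF y (snd a) (snd b))"
  unfolding koszul_def pd_G[OF assms] by (simp add: field_simps)

section \<open>The Levi-Civita connection of a warped metric\<close>

definition grad :: "'d \<Rightarrow> 'd" where
  "grad x = sharp GB x (\<lambda>w. pd w h x)"

lemma smooth_on_grad: "smooth_on B grad"
  unfolding grad_def[abs_def]
  by (intro base.smooth_on_sharp smooth_on_linear_pd[OF smooth_h] smooth_on_pd smooth_h)

lemma grad_works: "x \<in> B \<Longrightarrow> GB x (grad x) w = pd w h x"
  unfolding grad_def by (simp add: base.sharp_works smooth_on_linear_pd[OF smooth_h])

text \<open>The differential of the logarithm of \<open>h\<close>, the coefficient in the mixed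
  covariant derivatives. The direction comes first so that \<open>dlog a\<close> is a function on
  the base that can be differentiated.\<close>

definition dlog :: "'d \<Rightarrow> 'd \<Rightarrow> real" where
  "dlog a x = pd a h x / h x"

lemma smooth_on_dlog: "smooth_on B (dlog a)"
  unfolding dlog_def[abs_def]
  by (intro smooth_on_divide smooth_on_pd smooth_h base.open_S) (use h_pos in fastforce)

lemma dlog_zero: "x \<in> B \<Longrightarrow> dlog 0 x = 0"
  using linear_0[OF smooth_on_linear_pd[OF smooth_h]] by (simp add: dlog_def)

lemma pd_dlog_zero: "x \<in> B \<Longrightarrow> pd c (dlog 0) x = 0"
  by (rule pd_eq_zero[OF base.open_S]) (simp_all add: dlog_zero)

text \<open>In \<open>ricci_base\<close> the product \<open>dlog a x * dlog c x\<close> cancels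
  against a product of Christoffel symbols, and the second derivative left over becomes part of the
  Hessian of \<open>h\<close>.\<close>

lemma pd_dlog:
  assumes "x \<in> B"
  shows "pd c (dlog a) x = pd c (\<lambda>x. pd a h x) x / h x - dlog a x * dlog c x"
proof (rule pd_eqI)
  have "((\<lambda>x. pd a h x / h x) has_derivative
     (\<lambda>c. (pd c (\<lambda>x. pd a h x) x * h x - pd a h x * pd c h x) / (h x * h x))) (at x)"
    using h_pos[OF assms] smooth_on_has_derivative[OF smooth_on_pd[OF smooth_h] assms]
      smooth_on_has_derivative[OF smooth_h assms]
    by (intro has_derivative_divide') auto
  moreover have "(\<lambda>c. (pd c (\<lambda>x. pd a h x) x * h x - pd a h x * pd c h x) / (h x * h x)) =
     (\<lambda>c. pd c (\<lambda>x. pd a h x) x / h x - dlog a x * dlog c x)"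
    using h_pos[OF assms] by (auto simp: dlog_def field_simps)
  ultimately show "(dlog a has_derivative (\<lambda>c. pd c (\<lambda>x. pd a h x) x / h x - dlog a x * dlog c x)) (at x)"
    by (simp add: dlog_def[abs_def])
qed

text \<open>The classical covariant derivatives of a warped product, with the horizontal, vertical
  and mixed cases in one formula. The candidate is verified by pairing it with an arbitrary
  \<open>w\<close> and comparing with \<open>koszul_eq\<close>. The factor \<open>h x\<close> before
  \<open>GF\<close> is the total metric on vertical vectors divided by \<open>h x\<close>.\<close>

lemma christoffel_eq:
  assumes "x \<in> B" "y \<in> F"
  shows "christoffel G (x, y) a b =
    (christoffel GB x (fst a) (fst b) - (h x * GF y (snd a) (snd b)) *\<^sub>R grad x,
     christoffel GF y (snd a) (snd b) + dlog (fst a) x *\<^sub>R snd b + dlog (fst b) x *\<^sub>R snd a)"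
proof (rule total.christoffel_eqI)
  show "(x, y) \<in> B \<times> F" using assms by simp
  fix w
  note lin = base.linear_left[OF assms(1)] fib.linear_left[OF assms(2)]
  show "G (x, y) (christoffel GB x (fst a) (fst b) - (h x * GF y (snd a) (snd b)) *\<^sub>R grad x,
     christoffel GF y (snd a) (snd b) + dlog (fst a) x *\<^sub>R snd b + dlog (fst b) x *\<^sub>R snd a) w
     = koszul G (x, y) a b w"
    using h_pos[OF assms(1)]
    by (simp add: G_eq assms koszul_eq linear_add[OF lin(1)] linear_add[OF lin(2)]
       linear_diff[OF lin(1)] linear_cmul[OF lin(1)] linear_cmul[OF lin(2)] grad_works
       base.christoffel_works fib.christoffel_works dlog_def power2_eq_square field_simps)
qed

lemma pd_christoffel_eq:
  assumes "x \<in> B" "y \<in> F"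
  shows "pd c (\<lambda>z. christoffel G z a b) (x, y) =
    (pd (fst c) (\<lambda>x. christoffel GB x (fst a) (fst b)) x
      - ((h x * GF y (snd a) (snd b)) *\<^sub>R pd (fst c) grad x
         + (h x * pd (snd c) (\<lambda>y. GF y (snd a) (snd b)) y + pd (fst c) h x * GF y (snd a) (snd b)) *\<^sub>R grad x),
     pd (snd c) (\<lambda>y. christoffel GF y (snd a) (snd b)) y
      + pd (fst c) (dlog (fst a)) x *\<^sub>R snd b + pd (fst c) (dlog (fst b)) x *\<^sub>R snd a)" (is "_ = ?D c")
proof (rule pd_eqI)
  note d = has_derivative_fst_comp[OF base.smooth_on_christoffel assms(1)]
    has_derivative_snd_comp[OF fib.smooth_on_christoffel assms(2)]
    has_derivative_fst_comp[OF smooth_h assms(1)] has_derivative_fst_comp[OF smooth_on_grad assms(1)]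
    has_derivative_snd_comp[OF fib.smooth assms(2)] has_derivative_fst_comp[OF smooth_on_dlog assms(1)]
  have "((\<lambda>z. (christoffel GB (fst z) (fst a) (fst b) - (h (fst z) * GF (snd z) (snd a) (snd b)) *\<^sub>R grad (fst z),
     christoffel GF (snd z) (snd a) (snd b) + dlog (fst a) (fst z) *\<^sub>R snd b + dlog (fst b) (fst z) *\<^sub>R snd a))
      has_derivative ?D) (at (x, y))"
    by (auto intro!: derivative_eq_intros d simp: algebra_simps)
  then show "((\<lambda>z. christoffel G z a b) has_derivative ?D) (at (x, y))"
    by (rule has_derivative_transform_within_open[OF _ open_BF]) (use assms in \<open>auto simp: christoffel_eq\<close>)
qed

text \<open>Base directions in the trace reproduce the Ricci tensor of the base. Each of the
  \<open>DIM('e)\<close> fibre directions contributes minus the Hessian of \<open>h\<close> divided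
  by \<open>h\<close>.\<close>

lemma ricci_base:
  assumes "x \<in> B" "y \<in> F"
  shows "ricci_local G (x, y) (b, 0) (z, 0) =
    ricci_local GB x b z - (real DIM('e) / h x) * hessian_local GB h x b z"
proof -
  note simps = christoffel_eq[OF assms] pd_christoffel_eq[OF assms]
    base.christoffel_zero_left[OF assms(1)] base.christoffel_zero_right[OF assms(1)]
    fib.christoffel_zero_left[OF assms(2)] fib.christoffel_zero_right[OF assms(2)]
    base.zero_left[OF assms(1)] base.zero_right[OF assms(1)]
    fib.zero_left[OF assms(2)] fib.zero_right[OF assms(2)]
    base.pd_zero[OF assms(1)] fib.pd_zero[OF assms(2)] pd_dlog_zero[OF assms(1)] dlog_zero[OF assms(1)]
    base.pd_zero_direction[OF assms(1)] fib.pd_zero_direction[OF assms(2)]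
  have 1: "riemann_local G (x, y) (i, 0) (b, 0) (z, 0) \<bullet> (i, 0) = riemann_local GB x i b z \<bullet> i" for i
    by (simp add: riemann_local_def simps)
  have 2: "riemann_local G (x, y) (0, i) (b, 0) (z, 0) \<bullet> (0, i) = - hessian_local GB h x b z / h x"
    if "i \<in> Basis" for i
    using that h_pos[OF assms(1)]
    by (simp add: riemann_local_def simps pd_dlog[OF assms(1)] hessian_local_def inner_diff_left inner_add_left)
      (simp add: dlog_def field_simps)
  show ?thesis
    unfolding ricci_local_prod by (simp add: ricci_local_def 1 2)
qed

text \<open>This is \<open>(n - 1) |grad h|\<^sup>2 + h \<Delta>h\<close>, the Laplacian being the divergence of \<open>grad h\<close>.\<close>

definition fibre_coeff :: "nat \<Rightarrow> 'd \<Rightarrow> real" where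
  "fibre_coeff n x = (real n - 1) * pd (grad x) h x
     + (\<Sum>i\<in>Basis. (h x *\<^sub>R (pd i grad x + christoffel GB x i (grad x))) \<bullet> i)"

text \<open>Base directions in the trace contribute the Laplacian term. Fibre directions give the
  curvature of the fibre, corrected by the squared length of the gradient of
  \<open>h\<close>.\<close>

lemma ricci_fibre:
  assumes "x \<in> B" "y \<in> F"
  shows "ricci_local G (x, y) (0, v) (0, w) = ricci_local GF y v w - fibre_coeff DIM('e) x * GF y v w"
proof -
  note lin = base.linear_christoffel[OF assms(1)]
  have lin1: "linear (\<lambda>a. pd a h x)" by (rule smooth_on_linear_pd[OF smooth_h assms(1)])
  note simps = christoffel_eq[OF assms] pd_christoffel_eq[OF assms]
    base.christoffel_zero_left[OF assms(1)] base.christoffel_zero_right[OF assms(1)]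
    fib.christoffel_zero_left[OF assms(2)] fib.christoffel_zero_right[OF assms(2)]
    base.zero_left[OF assms(1)] base.zero_right[OF assms(1)]
    fib.zero_left[OF assms(2)] fib.zero_right[OF assms(2)]
    base.pd_zero[OF assms(1)] fib.pd_zero[OF assms(2)] pd_dlog_zero[OF assms(1)] dlog_zero[OF assms(1)]
    base.pd_zero_direction[OF assms(1)] fib.pd_zero_direction[OF assms(2)]
    linear_neg[OF lin] linear_cmul[OF lin] linear_neg[OF lin1] linear_cmul[OF lin1] linear_0[OF lin1]
    linear_cmul[OF fib.linear_right[OF assms(2)]]
    linear_0[OF smooth_on_linear_pd[OF smooth_on_grad assms(1)]]
  have 1: "riemann_local G (x, y) (i, 0) (0, v) (0, w) \<bullet> (i, 0) =
      - GF y v w * ((h x *\<^sub>R (pd i grad x + christoffel GB x i (grad x))) \<bullet> i)" for i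
    using h_pos[OF assms(1)]
    by (simp add: riemann_local_def simps inner_diff_left inner_add_left)
      (simp add: dlog_def field_simps)
  have 2: "riemann_local G (x, y) (0, i) (0, v) (0, w) \<bullet> (0, i) = riemann_local GF y i v w \<bullet> i
      - pd (grad x) h x * (GF y v w * (i \<bullet> i) - (v \<bullet> i) * GF y i w)" for i
    using h_pos[OF assms(1)]
    by (simp add: riemann_local_def simps dlog_def inner_diff_left inner_add_left)
      (simp add: field_simps)
  \<comment> \<open>The first summand counts the dimension; the second reassembles
    \<open>GF y v w\<close> from the expansion of \<open>v\<close> in \<open>Basis\<close>. This is
    the origin of the factor n - 1.\<close>
  have "(\<Sum>i\<in>Basis. GF y v w * (i \<bullet> i) - (v \<bullet> i) * GF y i w) = (real DIM('e) - 1) * GF y v w"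
    by (simp add: sum_subtractf fib.expand_left[OF assms(2), symmetric] algebra_simps)
  then have "(\<Sum>i\<in>Basis. riemann_local G (x, y) (0, i) (0, v) (0, w) \<bullet> (0, i)) =
     ricci_local GF y v w - pd (grad x) h x * ((real DIM('e) - 1) * GF y v w)"
    by (simp add: 2 sum_subtractf ricci_local_def sum_distrib_left[symmetric])
  moreover have "(\<Sum>i\<in>Basis. riemann_local G (x, y) (i, 0) (0, v) (0, w) \<bullet> (i, 0)) =
     - GF y v w * (\<Sum>i\<in>Basis. (h x *\<^sub>R (pd i grad x + christoffel GB x i (grad x))) \<bullet> i)"
    unfolding 1 by (rule sum_distrib_left[symmetric])
  ultimately show ?thesis
    unfolding ricci_local_prod[of G] fibre_coeff_def by (simp only:) (simp add: algebra_simps)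
qed

text \<open>The covariant derivative of one horizontal coordinate field along another is the lift of
  that on the base, so no extra term appears. Applied twice, this carries the Hessian of
  \<open>f\<close> from the full product down to the first factor.\<close>

lemma hessian_base:
  assumes "smooth_on B f" "x \<in> B" "y \<in> F" "\<And>z. z \<in> B \<times> F \<Longrightarrow> f' z = f (fst z)"
  shows "hessian_local G f' (x, y) (a, 0) (b, 0) = hessian_local GB f x a b"
proof -
  have pd1: "pd c f' (x, y) = pd (fst c) f x" if "x \<in> B" "y \<in> F" for c x y
    by (rule pd_eqI, rule has_derivative_transform_within_open[OF has_derivative_fst_comp[OF assms(1)] open_BF])
      (use that assms(4) in auto)
  have "pd a (\<lambda>z. pd (b, 0) f' z) (x, y) = pd a' (\<lambda>x. pd b f x) x" if "a = (a', 0)" for a a'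
  proof -
    have "((\<lambda>z. pd (b, 0) f' z) has_derivative (\<lambda>a. pd (fst a) (\<lambda>x. pd b f x) x)) (at (x, y))"
      by (rule has_derivative_transform_within_open
          [OF has_derivative_fst_comp[OF smooth_on_pd[OF assms(1)] assms(2)] open_BF])
        (use assms(2,3) in \<open>auto simp: pd1\<close>)
    from pd_eqI[OF this, of a] show ?thesis using that by simp
  qed
  then show ?thesis
    by (simp add: hessian_local_def christoffel_eq[OF assms(2,3)] pd1 assms(2,3)
        fib.zero_left[OF assms(3)] fib.christoffel_zero_left[OF assms(3)])
qed

text \<open>\<Lambda> and \<psi> are numbers belonging to the one point considered, so they may come
  from functions that vary over the total space and the base.\<close>

lemma ricci_base_of_einstein:
  assumes "x \<in> B" "y \<in> F"
    and "\<And>a b. ricci_local G (x, y) a b = \<Lambda> * G (x, y) a b"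
    and "\<And>a b. hessian_local GB h x a b = \<psi> * GB x a b"
  shows "ricci_local GB x a b = (\<Lambda> + real DIM('e) / h x * \<psi>) * GB x a b"
  using ricci_base[OF assms(1,2), of a b] assms(3)[of "(a, 0)" "(b, 0)"] assms(4)[of a b]
  by (simp add: G_eq[OF assms(1,2)] fib.zero_left[OF assms(2)] algebra_simps)

lemma ricci_fibre_of_einstein:
  assumes "x \<in> B" "y \<in> F"
    and "\<And>a b. ricci_local G (x, y) a b = \<Lambda> * G (x, y) a b"
  shows "ricci_local GF y a b = (\<Lambda> * (h x)\<^sup>2 + fibre_coeff DIM('e) x) * GF y a b"
  using ricci_fibre[OF assms(1,2), of a b] assms(3)[of "(0, a)" "(0, b)"]
  by (simp add: G_eq[OF assms(1,2)] base.zero_left[OF assms(1)] algebra_simps)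

end

subsection \<open>Product charts\<close>

text \<open>The part of \<open>is_chart\<close> on which coordinate computations rest. It passes to
  product charts without reference to the topologies of the factors.\<close>

definition regular_chart :: "('a, 'e::euclidean_space) chart \<Rightarrow> bool" where
  "regular_chart c \<longleftrightarrow> open (chart_image c) \<and> inj_on (chart_map c) (chart_dom c)"

lemma chart_dom_product: "chart_dom (product_chart c d) = chart_dom c \<times> chart_dom d"
  and chart_map_product: "chart_map (product_chart c d) = map_prod (chart_map c) (chart_map d)"
  by (simp_all add: product_chart_def)

lemma chart_image_product: "chart_image (product_chart c d) = chart_image c \<times> chart_image d"
  by (auto simp: chart_dom_product chart_map_product)

lemma chart_inv_map: "\<lbrakk>regular_chart c; p \<in> chart_dom c\<rbrakk> \<Longrightarrow> chart_inv c (chart_map c p) = p"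
  by (simp add: regular_chart_def)

lemma regular_chart_product:
  assumes "regular_chart c" "regular_chart d"
  shows "regular_chart (product_chart c d)"
  unfolding regular_chart_def chart_image_product
  using assms by (auto simp: regular_chart_def chart_dom_product chart_map_product
      intro!: open_Times map_prod_inj_on)

lemma chart_inv_product:
  assumes "regular_chart c" "regular_chart d" "x \<in> chart_image c" "y \<in> chart_image d"
  shows "chart_inv (product_chart c d) (x, y) = (chart_inv c x, chart_inv d y)"
proof -
  obtain p q where p: "p \<in> chart_dom c" "x = chart_map c p" and q: "q \<in> chart_dom d" "y = chart_map d q"
    using assms(3,4) by auto
  have "(x, y) = chart_map (product_chart c d) (p, q)"
    by (simp add: chart_map_product p q)
  moreover have "(p, q) \<in> chart_dom (product_chart c d)"
    by (simp add: chart_dom_product p q)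
  ultimately show ?thesis
    using chart_inv_map[OF regular_chart_product[OF assms(1,2)], of "(p, q)"]
    by (simp add: chart_inv_map assms(1,2) p q)
qed

text \<open>\<open>s\<close> is a differentiable local section of the projection \<open>P\<close>
  through \<open>z\<close>, so \<open>F\<close> is locally \<open>F'\<close> composed with
  \<open>s\<close>; this gives the converse direction. The equivalence matters because
  \<open>tangent\<close> returns 0 on functions that are not differentiable, and both sides must
  take this default together.\<close>

lemma differentiable_comp_projection:
  assumes U: "open U" "z \<in> U" "\<And>z. z \<in> U \<Longrightarrow> F' z = F (P z)" and P: "bounded_linear P"
    and V: "open V" "P z \<in> V" "s ` V \<subseteq> U" "\<And>x. x \<in> V \<Longrightarrow> P (s x) = x" "s (P z) = z"
    and s: "(s has_derivative J) (at (P z))"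
  shows "F' differentiable (at z) \<longleftrightarrow> F differentiable (at (P z))"
    and "F differentiable (at (P z)) \<Longrightarrow> pd w F' z = pd (P w) F (P z)"
proof -
  have der: "(F' has_derivative (\<lambda>a. D (P a))) (at z)" if "(F has_derivative D) (at (P z))" for D
    by (rule has_derivative_transform_within_open
        [OF has_derivative_compose[OF bounded_linear_imp_has_derivative[OF P] that] U(1,2)])
      (simp add: U(3))
  have "F differentiable (at (P z))" if dF': "F' differentiable (at z)"
  proof -
    obtain D where "(F' has_derivative D) (at (s (P z)))"
      using dF' V(5) unfolding differentiable_def by auto
    from has_derivative_compose[OF s this]
    have "(F has_derivative (\<lambda>a. D (J a))) (at (P z))"
      by (rule has_derivative_transform_within_open[OF _ V(1,2)]) (use U(3) V(3,4) in auto)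
    then show ?thesis by (rule differentiableI)
  qed
  then show "F' differentiable (at z) \<longleftrightarrow> F differentiable (at (P z))"
    using der differentiableI unfolding differentiable_def by blast
  show "pd w F' z = pd (P w) F (P z)" if "F differentiable (at (P z))"
    using der[OF that[unfolded frechet_derivative_works]] by (rule pd_eqI)
qed

lemma tangent_product_fst:
  assumes c: "regular_chart c" and d: "regular_chart d"
    and p: "p \<in> chart_dom c" "q \<in> chart_dom d"
  shows "pushforward fst (tangent (product_chart c d) (p, q) w) = tangent c p (fst w)"
proof
  fix f :: "'a \<Rightarrow> real"
  let ?z = "(chart_map c p, chart_map d q)"
  let ?F = "f \<circ> chart_inv c" and ?F' = "(f \<circ> fst) \<circ> chart_inv (product_chart c d)"
  have o: "open (chart_image c \<times> chart_image d)" "open (chart_image c)"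
    using c d by (auto simp: regular_chart_def open_Times)
  have eq: "?F' z = ?F (fst z)" if "z \<in> chart_image c \<times> chart_image d" for z
    using that chart_inv_product[OF c d] by auto
  \<comment> \<open>The section of the first projection freezes the second coordinate at that of
    \<open>q\<close>.\<close>
  have s: "((\<lambda>x. (x, chart_map d q)) has_derivative (\<lambda>a. (a, 0))) (at (fst ?z))"
    by (auto intro!: derivative_eq_intros)
  have "?F' differentiable (at ?z) \<longleftrightarrow> ?F differentiable (at (fst ?z))"
    by (rule differentiable_comp_projection(1)[where F' = ?F' and F = ?F and P = fst,
        OF o(1) _ eq bounded_linear_fst o(2) _ _ _ _ s])
      (use p in auto)
  moreover have "pd w ?F' ?z = pd (fst w) ?F (fst ?z)" if "?F differentiable (at (fst ?z))"
    by (rule differentiable_comp_projection(2)[where F' = ?F' and F = ?F and P = fst,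
        OF o(1) _ eq bounded_linear_fst o(2) _ _ _ _ s that])
      (use p in auto)
  ultimately show "pushforward fst (tangent (product_chart c d) (p, q) w) f = tangent c p (fst w) f"
    by (simp add: pushforward_def tangent_def chart_map_product)
qed

lemma tangent_product_snd:
  assumes c: "regular_chart c" and d: "regular_chart d"
    and p: "p \<in> chart_dom c" "q \<in> chart_dom d"
  shows "pushforward snd (tangent (product_chart c d) (p, q) w) = tangent d q (snd w)"
proof
  fix f :: "'c \<Rightarrow> real"
  let ?z = "(chart_map c p, chart_map d q)"
  let ?F = "f \<circ> chart_inv d" and ?F' = "(f \<circ> snd) \<circ> chart_inv (product_chart c d)"
  have o: "open (chart_image c \<times> chart_image d)" "open (chart_image d)"
    using c d by (auto simp: regular_chart_def open_Times)
  have eq: "?F' z = ?F (snd z)" if "z \<in> chart_image c \<times> chart_image d" for z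
    using that chart_inv_product[OF c d] by auto
  have s: "((\<lambda>y. (chart_map c p, y)) has_derivative (\<lambda>a. (0, a))) (at (snd ?z))"
    by (auto intro!: derivative_eq_intros)
  have "?F' differentiable (at ?z) \<longleftrightarrow> ?F differentiable (at (snd ?z))"
    by (rule differentiable_comp_projection(1)[where F' = ?F' and F = ?F and P = snd,
        OF o(1) _ eq bounded_linear_snd o(2) _ _ _ _ s])
      (use p in auto)
  moreover have "pd w ?F' ?z = pd (snd w) ?F (snd ?z)" if "?F differentiable (at (snd ?z))"
    by (rule differentiable_comp_projection(2)[where F' = ?F' and F = ?F and P = snd,
        OF o(1) _ eq bounded_linear_snd o(2) _ _ _ _ s that])
      (use p in auto)
  ultimately show "pushforward snd (tangent (product_chart c d) (p, q) w) f = tangent d q (snd w) f"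
    by (simp add: pushforward_def tangent_def chart_map_product)
qed

lemma metric_coord_warped:
  assumes "regular_chart c" "regular_chart d" "x \<in> chart_image c" "y \<in> chart_image d"
  shows "metric_coord (product_chart c d) (warped_metric g f g') (x, y) a b =
    metric_coord c g x (fst a) (fst b) + (f (chart_inv c x))\<^sup>2 * metric_coord d g' y (snd a) (snd b)"
proof -
  have "chart_inv c x \<in> chart_dom c" "chart_inv d y \<in> chart_dom d"
    using assms(3,4) by (simp_all add: inv_into_into)
  note tangent = tangent_product_fst[OF assms(1,2) this] tangent_product_snd[OF assms(1,2) this]
  show ?thesis
    by (simp add: metric_coord_def warped_metric_def chart_inv_product[OF assms] tangent)
qed

text \<open>Stated for \<open>regular_chart\<close> and \<open>local_metric\<close>, so that the
  base may itself be a product chart with a warped metric. This permits the second warping.\<close>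

lemma warped_local_metric_coord:
  assumes "regular_chart c" "regular_chart d"
    and "local_metric (chart_image c) (metric_coord c g)"
    and "local_metric (chart_image d) (metric_coord d g')"
    and "smooth_on (chart_image c) (f \<circ> chart_inv c)" "\<And>p. f p > 0"
  shows "warped_local (chart_image c) (metric_coord c g) (chart_image d) (metric_coord d g')
    (f \<circ> chart_inv c) (metric_coord (product_chart c d) (warped_metric g f g'))"
  by (intro warped_local.intro warped_local_axioms.intro assms)
    (simp_all add: metric_coord_warped assms(1,2,6))

section \<open>From charts to manifolds: Einstein factors and the soliton equation\<close>

lemma smooth_atlas_regular_chart: "\<lbrakk>smooth_atlas A; c \<in> A\<rbrakk> \<Longrightarrow> regular_chart c"
  unfolding smooth_atlas_def is_chart_def regular_chart_def homeomorphism_def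
  using inj_on_inverseI[of "chart_dom c" "chart_inv c" "chart_map c"] by blast

lemma smooth_atlas_chart_exists: "smooth_atlas A \<Longrightarrow> \<exists>c\<in>A. p \<in> chart_dom c"
  unfolding smooth_atlas_def by blast

lemma semi_riemannian_local_metric:
  assumes "semi_riemannian A g" "c \<in> A"
  shows "local_metric (chart_image c) (metric_coord c g)"
proof
  show "open (chart_image c)"
    using assms smooth_atlas_regular_chart[of A c]
    by (simp add: semi_riemannian_def regular_chart_def)
qed (use assms in \<open>auto simp: semi_riemannian_def\<close>)

text \<open>As \<open>G x a a\<close> may vanish for an indefinite metric, nondegeneracy supplies a
  partner \<open>b\<close> depending on \<open>x\<close>. The pair keeps a nonzero product near
  \<open>x\<close> only, so smoothness is proved locally.\<close>

lemma (in local_metric) smooth_on_ricci_factor: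
  assumes "\<And>x a b. x \<in> S \<Longrightarrow> ricci_local G x a b = \<mu> x * G x a b"
  shows "smooth_on S \<mu>"
proof (rule smooth_on_local)
  fix x assume x: "x \<in> S"
  obtain a :: 'e where "a \<in> Basis" using nonempty_Basis by blast
  then have "a \<noteq> 0" by (rule nonzero_Basis)
  then obtain b where b: "G x a b \<noteq> 0" using nondegenerate[OF x] by blast
  define U where "U = {y \<in> S. G y a b \<noteq> 0}"
  have cont: "continuous_on S (\<lambda>y. G y a b)"
    using smooth[of a b] Ck_on_imp_continuous_on unfolding smooth_on_def by blast
  have "U = S \<inter> (\<lambda>y. G y a b) -` (- {0})" by (auto simp: U_def)
  then have U: "open U" using continuous_open_preimage[OF cont open_S, of "- {0}"] by auto
  have sub: "smooth_on U f" if "smooth_on S f" for f :: "'e \<Rightarrow> real"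
    using smooth_on_comp_linear[OF bounded_linear_ident U _ that] by (auto simp: U_def)
  have "smooth_on U (\<lambda>y. ricci_local G y a b / G y a b)"
    by (intro smooth_on_divide U sub smooth_on_ricci smooth) (simp add: U_def)
  then have "smooth_on U \<mu>"
    by (rule smooth_on_cong[OF U, rotated]) (simp add: U_def assms)
  then show "\<exists>U. open U \<and> x \<in> U \<and> smooth_on U \<mu>"
    using U x b by (auto simp: U_def)
qed

text \<open>The smoothness demanded by \<open>einstein\<close> is recovered from the equation
  itself. It suffices to exhibit at each point one factor that serves all charts around it.\<close>

lemma einsteinI:
  fixes A :: "('a::topological_space, 'e::euclidean_space) chart set"
  assumes sr: "semi_riemannian A g"
    and ex: "\<And>p. \<exists>m. \<forall>c\<in>A. p \<in> chart_dom c \<longrightarrow>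
      (\<forall>a b. ricci c g (chart_map c p) a b = m * metric_coord c g (chart_map c p) a b)"
  shows "einstein A g"
proof -
  obtain \<mu> where \<mu>: "\<And>p c a b. \<lbrakk>c \<in> A; p \<in> chart_dom c\<rbrakk> \<Longrightarrow>
      ricci c g (chart_map c p) a b = \<mu> p * metric_coord c g (chart_map c p) a b"
    using ex by metis
  have "smooth_on (chart_image c) (\<mu> \<circ> chart_inv c)" if c: "c \<in> A" for c
  proof (rule local_metric.smooth_on_ricci_factor[OF semi_riemannian_local_metric[OF sr c]])
    fix x a b assume x: "x \<in> chart_image c"
    then have "chart_inv c x \<in> chart_dom c" "chart_map c (chart_inv c x) = x"
      by (simp_all add: inv_into_into f_inv_into_f)
    with \<mu>[OF c, of "chart_inv c x" a b]
    show "ricci c g x a b = (\<mu> \<circ> chart_inv c) x * metric_coord c g x a b" by simp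
  qed
  then show ?thesis using \<mu> unfolding einstein_def smooth_fun_def by blast
qed

lemma killing_soliton_ricci:
  assumes "ricci_bourguignon_soliton A g X l \<rho>" "killing A g X" "c \<in> A" "p \<in> chart_dom c"
  shows "ricci c g (chart_map c p) a b =
    (l + \<rho> * scalar_curvature A g p) * metric_coord c g (chart_map c p) a b"
proof -
  have "ricci c g (chart_map c p) a b + 1 / 2 * lie_deriv c X g (chart_map c p) a b =
        l * metric_coord c g (chart_map c p) a b +
        \<rho> * scalar_curvature A g p * metric_coord c g (chart_map c p) a b"
    using assms(1,3,4) unfolding ricci_bourguignon_soliton_def by blast
  moreover have "lie_deriv c X g (chart_map c p) a b = 0"
    using assms(2-4) unfolding killing_def by blast
  ultimately show ?thesis by (simp add: algebra_simps)
qed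

theorem theorem3p2:
  fixes A1 :: "('a::{t2_space,second_countable_topology}, 'd::euclidean_space) chart set"
    and A2 :: "('b::{t2_space,second_countable_topology}, 'e::euclidean_space) chart set"
    and A3 :: "('c::{t2_space,second_countable_topology}, 'k::euclidean_space) chart set"
    and g1 :: "'a metric_tensor" and g2 :: "'b metric_tensor" and g3 :: "'c metric_tensor"
    and f :: "'a \<Rightarrow> real" and h :: "'a \<times> 'b \<Rightarrow> real"
    and X :: "(('a \<times> 'b) \<times> 'c) vfield" and l \<rho> :: real
  defines "Abar \<equiv> product_atlas A1 A2"
    and "gbar \<equiv> warped_metric g1 f g2"
  defines "A \<equiv> product_atlas Abar A3"
    and "g \<equiv> warped_metric gbar h g3"
  assumes "semi_riemannian A1 g1" and "semi_riemannian A2 g2" and "semi_riemannian A3 g3"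
    and "smooth_fun A1 f" and "\<And>p. f p > 0"
    and "smooth_fun Abar h" and "\<And>p. h p > 0"
    and "ricci_bourguignon_soliton A g X l \<rho>"
    and "killing A g X"
  shows "((\<exists>\<sigma>. smooth_fun A \<sigma> \<and> hessian_proportional A g (f \<circ> fst \<circ> fst) \<sigma>) \<and>
          (\<exists>\<psi>. smooth_fun Abar \<psi> \<and> hessian_proportional Abar gbar h \<psi>) \<longrightarrow> einstein A1 g1) \<and>
         ((\<exists>\<psi>. smooth_fun Abar \<psi> \<and> hessian_proportional Abar gbar h \<psi>) \<longrightarrow> einstein A2 g2) \<and>
         einstein A3 g3"
proof -
  note sr = \<open>semi_riemannian A1 g1\<close> \<open>semi_riemannian A2 g2\<close> \<open>semi_riemannian A3 g3\<close>
  have at: "smooth_atlas A1" "smooth_atlas A2" "smooth_atlas A3"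
    using sr by (auto simp: semi_riemannian_def)
  note reg = at[THEN smooth_atlas_regular_chart]
  have mem: "product_chart c1 c2 \<in> Abar" if "c1 \<in> A1" "c2 \<in> A2" for c1 c2
    using that unfolding Abar_def product_atlas_def by blast
  have memA: "product_chart (product_chart c1 c2) c3 \<in> A" if "c1 \<in> A1" "c2 \<in> A2" "c3 \<in> A3" for c1 c2 c3
    using mem[OF that(1,2)] that(3) unfolding A_def product_atlas_def by blast
  have f_smooth: "smooth_on (chart_image c1) (f \<circ> chart_inv c1)" if "c1 \<in> A1" for c1
    using that assms(8) by (simp add: smooth_fun_def)
  have W1: "warped_local (chart_image c1) (metric_coord c1 g1) (chart_image c2) (metric_coord c2 g2)
      (f \<circ> chart_inv c1) (metric_coord (product_chart c1 c2) gbar)" if "c1 \<in> A1" "c2 \<in> A2" for c1 c2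
    unfolding gbar_def using that
    by (intro warped_local_metric_coord reg semi_riemannian_local_metric[OF sr(1)]
        semi_riemannian_local_metric[OF sr(2)] f_smooth assms(9))
  have W2: "warped_local (chart_image (product_chart c1 c2)) (metric_coord (product_chart c1 c2) gbar)
      (chart_image c3) (metric_coord c3 g3) (h \<circ> chart_inv (product_chart c1 c2))
      (metric_coord (product_chart (product_chart c1 c2) c3) g)"
    if c: "c1 \<in> A1" "c2 \<in> A2" "c3 \<in> A3" for c1 c2 c3
    unfolding g_def
  proof (rule warped_local_metric_coord)
    show "regular_chart (product_chart c1 c2)" using c reg by (intro regular_chart_product)
    show "regular_chart c3" using c reg by simp
    interpret warped_local "chart_image c1" "metric_coord c1 g1" "chart_image c2" "metric_coord c2 g2"
      "f \<circ> chart_inv c1" "metric_coord (product_chart c1 c2) gbar"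
      by (rule W1[OF c(1,2)])
    show "local_metric (chart_image (product_chart c1 c2)) (metric_coord (product_chart c1 c2) gbar)"
      unfolding chart_image_product by (rule total.local_metric_axioms)
    show "local_metric (chart_image c3) (metric_coord c3 g3)"
      by (rule semi_riemannian_local_metric[OF sr(3) c(3)])
    show "smooth_on (chart_image (product_chart c1 c2)) (h \<circ> chart_inv (product_chart c1 c2))"
      using assms(10) mem[OF c(1,2)] by (simp add: smooth_fun_def)
  qed (rule assms(11))
  define \<Lambda> where "\<Lambda> p = l + \<rho> * scalar_curvature A g p" for p
  have ricci: "ricci (product_chart (product_chart c1 c2) c3) g ((chart_map c1 p1, chart_map c2 p2), chart_map c3 p3) a b
     = \<Lambda> ((p1, p2), p3) * metric_coord (product_chart (product_chart c1 c2) c3) g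
        ((chart_map c1 p1, chart_map c2 p2), chart_map c3 p3) a b"
    if "c1 \<in> A1" "c2 \<in> A2" "c3 \<in> A3" "p1 \<in> chart_dom c1" "p2 \<in> chart_dom c2" "p3 \<in> chart_dom c3"
    for c1 c2 c3 p1 p2 p3 a b
    using killing_soliton_ricci[OF assms(12,13) memA[OF that(1-3)], of "((p1, p2), p3)" a b] that(4-6)
    by (simp add: chart_dom_product chart_map_product \<Lambda>_def)
  have in_image: "(chart_map c1 p1, chart_map c2 p2) \<in> chart_image (product_chart c1 c2)"
    if "p1 \<in> chart_dom c1" "p2 \<in> chart_dom c2" for c1 :: "('a, 'd) chart" and c2 :: "('b, 'e) chart" and p1 p2
    using that unfolding chart_image_product by blast
  \<comment> \<open>A chosen chart around every point of each factor, for use at the auxiliary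
    points below.\<close>
  obtain C1 C2 C3 where C: "\<And>p. C1 p \<in> A1" "\<And>p. C2 p \<in> A2" "\<And>p. C3 p \<in> A3"
    "\<And>p. p \<in> chart_dom (C1 p)" "\<And>p. p \<in> chart_dom (C2 p)" "\<And>p. p \<in> chart_dom (C3 p)"
    using at[THEN smooth_atlas_chart_exists] by metis

  have E3: "einstein A3 g3"
  proof (rule einsteinI[OF sr(3)])
    \<comment> \<open>\<open>p1\<close> and \<open>p2\<close> are arbitrary auxiliary points, taken
      in their chosen charts. The factor found by unification then depends on these and on
      \<open>p3\<close>, but not on the chart \<open>c\<close>, as the order of quantifiers
      requires.\<close>
    fix p3 and p1 :: 'a and p2 :: 'b
    show "\<exists>m. \<forall>c\<in>A3. p3 \<in> chart_dom c \<longrightarrow>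
      (\<forall>a b. ricci c g3 (chart_map c p3) a b = m * metric_coord c g3 (chart_map c p3) a b)"
      by (intro exI ballI impI allI)
        (rule warped_local.ricci_fibre_of_einstein[OF W2[OF C(1)[of p1] C(2)[of p2]] in_image[OF C(4,5)]
          imageI ricci[OF C(1,2) _ C(4,5)]])
  qed

  \<comment> \<open>The product of the first two factors is the base of the outer warping, so the
    Hessian condition on \<open>h\<close> makes its Ricci tensor proportional to
    \<open>gbar\<close>. The point \<open>r\<close> of the third factor is arbitrary.\<close>
  have bar: "ricci (product_chart c1 c2) gbar (chart_map c1 p1, chart_map c2 p2) a b =
      (\<Lambda> ((p1, p2), r) + real DIM('k) / h (p1, p2) * \<psi> (p1, p2)) *
        metric_coord (product_chart c1 c2) gbar (chart_map c1 p1, chart_map c2 p2) a b"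
    if \<psi>: "hessian_proportional Abar gbar h \<psi>"
      and c: "c1 \<in> A1" "c2 \<in> A2" and p: "p1 \<in> chart_dom c1" "p2 \<in> chart_dom c2"
    for \<psi> c1 c2 p1 p2 r a b
  proof -
    have "hessian (product_chart c1 c2) gbar h (chart_map c1 p1, chart_map c2 p2) a b =
        \<psi> (p1, p2) * metric_coord (product_chart c1 c2) gbar (chart_map c1 p1, chart_map c2 p2) a b" for a b
      using \<psi>[unfolded hessian_proportional_def, rule_format, OF mem[OF c], of "(p1, p2)" a b] p
      by (simp add: chart_dom_product chart_map_product)
    from warped_local.ricci_base_of_einstein[OF W2[OF c C(3)[of r]] in_image[OF p]
        imageI[OF C(6)[of r]] ricci[OF c C(3) p C(6)] this, of a b]
    show ?thesis
      using chart_inv_map[OF regular_chart_product[OF reg(1)[OF c(1)] reg(2)[OF c(2)]], of "(p1, p2)"] p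
      by (simp add: chart_dom_product chart_map_product)
  qed

  \<comment> \<open>The second factor is the fibre of the inner warping, and \<open>bar\<close>
    supplies the proportionality of the Ricci tensor on its total space.\<close>
  have E2: "einstein A2 g2" if \<psi>: "hessian_proportional Abar gbar h \<psi>" for \<psi>
  proof (rule einsteinI[OF sr(2)])
    fix p2 and p1 :: 'a and p3 :: 'c
    show "\<exists>m. \<forall>c\<in>A2. p2 \<in> chart_dom c \<longrightarrow>
      (\<forall>a b. ricci c g2 (chart_map c p2) a b = m * metric_coord c g2 (chart_map c p2) a b)"
      by (intro exI ballI impI allI)
        (rule warped_local.ricci_fibre_of_einstein[OF W1[OF C(1)[of p1]] imageI[OF C(4)] imageI
          bar[where r = p3, OF \<psi> C(1) _ C(4)]])
  qed

  have E1: "einstein A1 g1" if \<psi>: "hessian_proportional Abar gbar h \<psi>"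
    and \<sigma>: "hessian_proportional A g (f \<circ> fst \<circ> fst) \<sigma>" for \<psi> \<sigma>
  proof (rule einsteinI[OF sr(1)])
    fix p1 and p2 :: 'b and p3 :: 'c
    \<comment> \<open>The Hessian equation for \<open>f\<close> on the full product is evaluated at
      \<open>((p1, p2), p3)\<close> on vectors tangent to the first factor, and both sides are
      reduced through the two warpings.\<close>
    have hess: "hessian c g1 f (chart_map c p1) a b =
        \<sigma> ((p1, p2), p3) * metric_coord c g1 (chart_map c p1) a b"
      if c: "c \<in> A1" and p: "p1 \<in> chart_dom c" for c a b
    proof -
      let ?x = "chart_map c p1" and ?y = "chart_map (C2 p2) p2" and ?z = "chart_map (C3 p3) p3"
      let ?cb = "product_chart c (C2 p2)"
      let ?c = "product_chart ?cb (C3 p3)"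
      note W1 = W1[OF c C(2)[of p2]] and W2 = W2[OF c C(2)[of p2] C(3)[of p3]]
      note rc = reg(1)[OF c] reg(2)[OF C(2)[of p2]] reg(3)[OF C(3)[of p3]]
      note rcb = regular_chart_product[OF rc(1,2)]
      note im = imageI[OF p, of "chart_map c"] imageI[OF C(5)[of p2], of "chart_map (C2 p2)"]
        imageI[OF C(6)[of p3], of "chart_map (C3 p3)"]
      have fbar: "smooth_on (chart_image ?cb) (\<lambda>z. (f \<circ> chart_inv c) (fst z))"
        by (rule smooth_on_comp_linear[OF bounded_linear_fst _ _ f_smooth[OF c]])
          (use rcb in \<open>auto simp: regular_chart_def chart_image_product\<close>)
      have "\<sigma> ((p1, p2), p3) * metric_coord ?c g ((?x, ?y), ?z) ((a, 0), 0) ((b, 0), 0) =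
         hessian ?c g (f \<circ> fst \<circ> fst) ((?x, ?y), ?z) ((a, 0), 0) ((b, 0), 0)"
        using \<sigma>[unfolded hessian_proportional_def, rule_format, OF memA[OF c C(2) C(3)], of "((p1, p2), p3)"]
          p C(5,6)
        by (simp add: chart_dom_product chart_map_product)
      also have "\<dots> = hessian_local (metric_coord ?cb gbar) (\<lambda>z. (f \<circ> chart_inv c) (fst z)) (?x, ?y) (a, 0) (b, 0)"
        by (rule warped_local.hessian_base[OF W2 fbar in_image[OF p C(5)] im(3)])
          (auto simp: chart_image_product chart_inv_product[OF rcb rc(3)] chart_inv_product[OF rc(1,2)])
      also have "\<dots> = hessian c g1 f ?x a b"
        by (rule warped_local.hessian_base[OF W1 f_smooth[OF c] im(1,2)]) simp
      \<comment> \<open>This equation does not extend the chain on the right: it rewrites the metric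
        term on the left side of the equality obtained so far.\<close>
      also have "metric_coord ?c g ((?x, ?y), ?z) ((a, 0), 0) ((b, 0), 0) = metric_coord c g1 ?x a b"
        by (simp add: warped_local.G_eq[OF W2 in_image[OF p C(5)] im(3)] warped_local.G_eq[OF W1 im(1,2)]
          local_metric.zero_left[OF semi_riemannian_local_metric[OF sr(3) C(3)] im(3)]
          local_metric.zero_left[OF semi_riemannian_local_metric[OF sr(2) C(2)] im(2)])
      finally show ?thesis by (rule sym)
    qed
    show "\<exists>m. \<forall>c\<in>A1. p1 \<in> chart_dom c \<longrightarrow>
      (\<forall>a b. ricci c g1 (chart_map c p1) a b = m * metric_coord c g1 (chart_map c p1) a b)"
    proof (intro exI ballI impI allI)
      fix c a b assume c: "c \<in> A1" "p1 \<in> chart_dom c"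
      \<comment> \<open>The two correction terms record the two passages to a base: the dimension of
        the third factor with \<open>h\<close> and \<psi>, then that of the second factor with
        \<open>f\<close> and \<sigma>.\<close>
      show "ricci c g1 (chart_map c p1) a b =
        (\<Lambda> ((p1, p2), p3) + real DIM('k) / h (p1, p2) * \<psi> (p1, p2) + real DIM('e) / f p1 * \<sigma> ((p1, p2), p3))
          * metric_coord c g1 (chart_map c p1) a b"
        using warped_local.ricci_base_of_einstein[OF W1[OF c(1) C(2)[of p2]] imageI[OF c(2)] imageI[OF C(5)]
          bar[where r = p3, OF \<psi> c(1) C(2) c(2) C(5)] hess[OF c]]
        by (simp add: chart_inv_map[OF reg(1)] c)
    qed
  qed
  show ?thesis using E1 E2 E3 by blast
qed

end
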